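(* Let $N,S,\ell,K_c$ be positive integers, let $X,B$ be non-negative integers with $X\le S$, put $L=\ell K_c$ and $R=K_c(N+\ell-1)+N(X-1)+2B+1$, let $\mathbb{F}_q$ be a finite field with $q\ge S+L$, and suppose $S\ge R$. Let $V_1,\dots,V_N,W$ be finite-dimensional vector spaces over $\mathbb{F}_q$ and $\Omega:V_1\times\cdots\times V_N\to W$ an $N$-linear map. Then the $N$-CSA code for $X$-secure $B$-byzantine $N$-linear coded distributed batch computation of $\Omega$ (defined in the context) has the following properties. (i) ($X$-security) For every $n\in[N]$ and every $\mathcal{X}\subset[S]$ with $|\mathcal{X}|=X$, the shares $(\widetilde{X^{(n)}}^{s})_{s\in\mathcal{X}}$ are independent of the data: $I\left((\widetilde{X^{(n)}}^{s})_{s\in\mathcal{X}};\,(x^{(n)}_l)_{l\in[L]}\right)=0$. (ii) (Recovery threshold $R$ with $B$ byzantine servers) From the responses of any $R=K_c(N+\ell-1)+N(X-1)+2B+1$ servers, of which at most $B$ (at positions unknown to the user) may be replaced by arbitrary elements of $W$ while all others equal the true answers $Y_s$, the user can recover $\Omega(x^{(1)}_l,\dots,x^{(N)}_l)$ for all $l\in[L]$. That is, for every $\mathcal{R}\subset[S]$ with $|\mathcal{R}|=R$ there is a function $d_{\mathcal{R}}:W^{\mathcal{R}}\to W^L$ such that, for all values of the data and of the noise vectors and for all $(Y'_s)_{s\in\mathcal{R}}\in W^{\mathcal{R}}$ with $|\{s\in\mathcal{R}:Y'_s\ne Y_s\}|\le B$, one has $d_{\mathcal{R}}((Y'_s)_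{s\in\mathcal{R}})=\left(\Omega(x^{(1)}_l,\dots,x^{(N)}_l)\right)_{l\in[L]}$.
   Context: Notation: $[n]=\{1,\dots,n\}$; $I(\cdot;\cdot)$ is mutual information. A map is $N$-linear if it is linear in each of its $N$ arguments separately. There are $N$ sources; the $n$-th holds $(x^{(n)}_1,\dots,x^{(n)}_L)$, $x^{(n)}_l\in V_n$ (random variables with an arbitrary joint distribution for the purposes of security). The code. Let $f_{1,1},f_{1,2},\dots,f_{\ell,K_c},\alpha_1,\dots,\alpha_S$ be $S+L$ distinct elements of $\mathbb{F}_q$. For $n\in[N]$, $l\in[\ell]$, $k\in[K_c]$, $x\in[X]$, let $z^{(n)}_{l,k,x}$ be noise vectors uniformly distributed on $V_n$, mutually independent over all indices and independent of all the data. For $l\in[\ell]$, $s\in[S]$ put $\Delta_s^{l,K_c}=\prod_{k\in[K_c]}(f_{l,k}-\alpha_s)$, and put $x^{(n)}_{l,k}=x^{(n)}_{K_c(l-1)+k}$. The share of the $n$-th source sent to server $s$ is $\widetilde{X^{(n)}}^s=(\widetilde{X^{(n)}}^s_1,\dots,\widetilde{X^{(n)}}^s_\ell)$ with $$\widetilde{X^{(n)}}^s_l=\Delta_s^{l,K_c}\sum_{k\in[K_c]}\left(\frac{1}{f_{l,k}-\alpha_s}x^{(n)}_{l,k}+\sum_{x\in[X]}\alpha_s^{x-1}z^{(n)}_{l,k,x}\right),$$ with the conventions $\alpha_s^0=1$ and $[0]=\emptyset$. The true answer of server $s$ is $$Y_s=\sum_{l\in[\ell]}\frac{1}{\Delta_s^{l,K_c}}\,\Omega\left(\widetilde{X^{(1)}}^s_l,\widetilde{X^{(2)}}^s_l,\dots,\widetilde{X^{(N)}}^s_l\right)\in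 W.$$ *)

theory Defs
  imports "HOL-Probability.Probability"
begin

(* The spaces V_1, ..., V_N are subspaces of one ambient vector space 'v (given by its scalar
   multiplication), so that a family of spaces indexed by a number n can be expressed. Every family
   V_1, ..., V_N arises in this way, e.g. inside its direct sum; the ambient space itself may have
   infinite dimension. *)
definition fin_dim_subspace ::
  "('q::field \<Rightarrow> 'v::ab_group_add \<Rightarrow> 'v) \<Rightarrow> 'v set \<Rightarrow> bool" where
  "fin_dim_subspace scaleV U \<longleftrightarrow>
     module.subspace scaleV U \<and> (\<exists>C. finite C \<and> module.span scaleV C = U)"

(* Elements of V_1 x ... x V_N are extensional functions on {1..N}. *)
definition multilinear_map ::
  "('q::field \<Rightarrow> 'v::ab_group_add \<Rightarrow> 'v) \<Rightarrow> ('q \<Rightarrow> 'w::ab_group_add \<Rightarrow> 'w) \<Rightarrow>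
   nat \<Rightarrow> (nat \<Rightarrow> 'v set) \<Rightarrow> ((nat \<Rightarrow> 'v) \<Rightarrow> 'w) \<Rightarrow> bool" where
  "multilinear_map scaleV scaleW N V \<Omega> \<longleftrightarrow>
     (\<forall>n\<in>{1..N}. \<forall>v\<in>(\<Pi>\<^sub>E i\<in>{1..N}. V i).
        (\<forall>a\<in>V n. \<forall>b\<in>V n. \<Omega> (v(n := a + b)) = \<Omega> (v(n := a)) + \<Omega> (v(n := b))) \<and>
        (\<forall>c. \<forall>a\<in>V n. \<Omega> (v(n := scaleV c a)) = scaleW c (\<Omega> (v(n := a)))))"

definition csa_points ::
  "nat \<Rightarrow> nat \<Rightarrow> nat \<Rightarrow> (nat \<Rightarrow> nat \<Rightarrow> 'q::field) \<Rightarrow> (nat \<Rightarrow> 'q) \<Rightarrow> bool" where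
  "csa_points ell Kc S f \<alpha> \<longleftrightarrow>
     inj_on (\<lambda>(l, k). f l k) ({1..ell} \<times> {1..Kc}) \<and> inj_on \<alpha> {1..S} \<and>
     (\<forall>l\<in>{1..ell}. \<forall>k\<in>{1..Kc}. \<forall>s\<in>{1..S}. f l k \<noteq> \<alpha> s)"

definition csa_Delta ::
  "nat \<Rightarrow> (nat \<Rightarrow> nat \<Rightarrow> 'q::field) \<Rightarrow> (nat \<Rightarrow> 'q) \<Rightarrow> nat \<Rightarrow> nat \<Rightarrow> 'q" where
  "csa_Delta Kc f \<alpha> s l = (\<Prod>k\<in>{1..Kc}. f l k - \<alpha> s)"

(* Component l of the share that a single source sends to server s; x and z are the data and the
   noise vectors of that source. *)
definition csa_share ::
  "('q::field \<Rightarrow> 'v::ab_group_add \<Rightarrow> 'v) \<Rightarrow> nat \<Rightarrow> nat \<Rightarrow>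
   (nat \<Rightarrow> nat \<Rightarrow> 'q) \<Rightarrow> (nat \<Rightarrow> 'q) \<Rightarrow>
   (nat \<Rightarrow> 'v) \<Rightarrow> (nat \<Rightarrow> nat \<Rightarrow> nat \<Rightarrow> 'v) \<Rightarrow> nat \<Rightarrow> nat \<Rightarrow> 'v" where
  "csa_share scaleV Kc X f \<alpha> x z s l =
     scaleV (csa_Delta Kc f \<alpha> s l)
       (\<Sum>k\<in>{1..Kc}. scaleV (1 / (f l k - \<alpha> s)) (x (Kc * (l - 1) + k)) +
          (\<Sum>t\<in>{1..X}. scaleV (\<alpha> s ^ (t - 1)) (z l k t)))"

definition csa_answer ::
  "('q::field \<Rightarrow> 'v::ab_group_add \<Rightarrow> 'v) \<Rightarrow> ('q \<Rightarrow> 'w::ab_group_add \<Rightarrow> 'w) \<Rightarrow>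
   nat \<Rightarrow> nat \<Rightarrow> nat \<Rightarrow> nat \<Rightarrow> ((nat \<Rightarrow> 'v) \<Rightarrow> 'w) \<Rightarrow>
   (nat \<Rightarrow> nat \<Rightarrow> 'q) \<Rightarrow> (nat \<Rightarrow> 'q) \<Rightarrow>
   (nat \<Rightarrow> nat \<Rightarrow> 'v) \<Rightarrow> (nat \<Rightarrow> nat \<Rightarrow> nat \<Rightarrow> nat \<Rightarrow> 'v) \<Rightarrow> nat \<Rightarrow> 'w" where
  "csa_answer scaleV scaleW N ell Kc X \<Omega> f \<alpha> x z s =
     (\<Sum>l\<in>{1..ell}. scaleW (1 / csa_Delta Kc f \<alpha> s l)
        (\<Omega> (\<lambda>n\<in>{1..N}. csa_share scaleV Kc X f \<alpha> (x n) (z n) s l)))"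

(* Random data x and random noise z on a probability space M. Apart from measurability, nothing is
   assumed about the joint distribution of the data. The noise vectors are uniform, mutually
   independent, and the family of all of them is independent of the family of all data. (The
   library's indep_var needs both variables to have the same type, hence indep_set applied to the
   generated sigma-algebras.) *)
definition csa_random_model ::
  "'m measure \<Rightarrow> nat \<Rightarrow> nat \<Rightarrow> nat \<Rightarrow> nat \<Rightarrow> (nat \<Rightarrow> 'v set) \<Rightarrow>
   ('m \<Rightarrow> nat \<Rightarrow> nat \<Rightarrow> 'v) \<Rightarrow> ('m \<Rightarrow> nat \<Rightarrow> nat \<Rightarrow> nat \<Rightarrow> nat \<Rightarrow> 'v) \<Rightarrow> bool" where
  "csa_random_model M N ell Kc X V x z \<longleftrightarrow>
     (let D = {1..N} \<times> {1..ell * Kc};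
          I = {1..N} \<times> {1..ell} \<times> {1..Kc} \<times> {1..X};
          MD = (\<lambda>(n, l). count_space (V n));
          MI = (\<lambda>(n, l, k, t). count_space (V n));
          data = (\<lambda>\<omega>. \<lambda>(n, l)\<in>D. x \<omega> n l);
          noise = (\<lambda>\<omega>. \<lambda>(n, l, k, t)\<in>I. z \<omega> n l k t)
      in prob_space M \<and>
         (\<forall>(n, l)\<in>D. (\<lambda>\<omega>. x \<omega> n l) \<in> measurable M (count_space (V n))) \<and>
         (\<forall>(n, l, k, t)\<in>I. (\<lambda>\<omega>. z \<omega> n l k t) \<in> measurable M (count_space (V n)) \<and>
            distr M (count_space (V n)) (\<lambda>\<omega>. z \<omega> n l k t) = uniform_count_measure (V n)) \<and>
         prob_space.indep_vars M MI (\<lambda>(n, l, k, t) \<omega>. z \<omega> n l k t) I \<and>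
         prob_space.indep_set M
           (sets (vimage_algebra (space M) noise (Pi\<^sub>M I MI)))
           (sets (vimage_algebra (space M) data (Pi\<^sub>M D MD))))"

(* Mutual information (logarithm to base b) of two discrete random variables, as in the notation
   I(U ; T) of the locale information_space. *)
definition discrete_mutual_information ::
  "'m measure \<Rightarrow> real \<Rightarrow> ('m \<Rightarrow> 'c) \<Rightarrow> ('m \<Rightarrow> 'd) \<Rightarrow> real" where
  "discrete_mutual_information M b U T =
     prob_space.mutual_information M b (count_space (U ` space M)) (count_space (T ` space M)) U T"

end

theory Submission
  imports Defs
begin

text \<open>Recovery: clearing the denominators of the answers, i.e. multiplying \<open>Y\<^sub>s\<close> by
  \<open>\<Prod>\<^sub>l \<Delta>\<^sub>s\<^sup>l\<close>, gives the value at \<open>\<alpha>\<^sub>s\<close> of a \<open>W\<close>-valued polynomial of degree less than \<open>R - 2B\<close>.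
  Two answer vectors consistent with the same responses agree on at least \<open>R - 2B\<close> servers, so these
  polynomials coincide, and their value at \<open>f\<^sub>l\<^sub>,\<^sub>k\<close> is a nonzero multiple of \<open>\<Omega>\<close> at the data of index
  \<open>(l, k)\<close>: all other terms of the sum contain the factor \<open>f\<^sub>l\<^sub>,\<^sub>k - \<alpha>\<close>, which vanishes there.

  Security: any change of the data can be compensated at \<open>X\<close> servers by translating the noise, since
  polynomials of degree less than \<open>X\<close> interpolate arbitrary values at \<open>X\<close> points. As the noise is
  uniform, the conditional distribution of the shares does not depend on the data.\<close>

section \<open>Vector-valued polynomial functions\<close>

(* A locale of its own: a constant defined in vector_space itself is captured by the global
   interpretation real_vector even inside vector_space. *)
locale coefficient_space = vector_space scale
  for scale :: "'a::field \<Rightarrow> 'b::ab_group_add \<Rightarrow> 'b"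
begin

text \<open>\<open>m\<close> counts coefficients: the degree is below \<open>m\<close>, and
  \<open>m = 0\<close> leaves only the zero function. A predicate on functions allows vectors as
  coefficients, and tracking \<open>U\<close> keeps noise obtained from coefficients inside the
  right \<open>V n\<close>.\<close>

definition polyfun :: "'b set \<Rightarrow> nat \<Rightarrow> ('a \<Rightarrow> 'b) \<Rightarrow> bool" where
  "polyfun U m p \<longleftrightarrow> (\<exists>c. (\<forall>i<m. c i \<in> U) \<and> (\<forall>a. p a = (\<Sum>i<m. scale (a ^ i) (c i))))"

section \<open>Closure rules with bounds on the number of coefficients\<close>

lemma polyfunI:
  "(\<And>i. i < m \<Longrightarrow> c i \<in> U) \<Longrightarrow> (\<And>a. p a = (\<Sum>i<m. scale (a ^ i) (c i))) \<Longrightarrow> polyfun U m p"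
  unfolding polyfun_def by blast

lemma polyfun_in: "subspace U \<Longrightarrow> polyfun U m p \<Longrightarrow> p a \<in> U"
  unfolding polyfun_def by (auto intro!: subspace_sum subspace_scale)

lemma polyfun_const: "c \<in> U \<Longrightarrow> polyfun U (Suc 0) (\<lambda>_. c)"
  by (rule polyfunI[where c = "\<lambda>_. c"]) auto

lemma polyfun_mono:
  assumes "subspace U" "polyfun U m p" "m \<le> m'"
  shows "polyfun U m' p"
proof -
  obtain c where c: "\<forall>i<m. c i \<in> U" "\<forall>a. p a = (\<Sum>i<m. scale (a ^ i) (c i))"
    using assms unfolding polyfun_def by blast
  show ?thesis
  proof (rule polyfunI[where c = "\<lambda>i. if i < m then c i else 0"])
    fix a
    have "(\<Sum>i<m'. scale (a ^ i) (if i < m then c i else 0)) = (\<Sum>i<m. scale (a ^ i) (c i))"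
      using \<open>m \<le> m'\<close> by (intro sum.mono_neutral_cong_right) auto
    then show "p a = (\<Sum>i<m'. scale (a ^ i) (if i < m then c i else 0))"
      using c by simp
  qed (use c subspace_0[OF assms(1)] in auto)
qed

lemma polyfun_add:
  assumes "subspace U" "polyfun U m p" "polyfun U m q"
  shows "polyfun U m (\<lambda>a. p a + q a)"
proof -
  obtain c c' where c: "\<forall>i<m. c i \<in> U" "\<forall>a. p a = (\<Sum>i<m. scale (a ^ i) (c i))"
    "\<forall>i<m. c' i \<in> U" "\<forall>a. q a = (\<Sum>i<m. scale (a ^ i) (c' i))"
    using assms unfolding polyfun_def by blast
  show ?thesis
    by (rule polyfunI[where c = "\<lambda>i. c i + c' i"])
       (use c subspace_add[OF assms(1)] in \<open>auto simp: scale_right_distrib sum.distrib\<close>)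
qed

lemma polyfun_scale:
  assumes "subspace U" "polyfun U m p"
  shows "polyfun U m (\<lambda>a. scale r (p a))"
proof -
  obtain c where c: "\<forall>i<m. c i \<in> U" "\<forall>a. p a = (\<Sum>i<m. scale (a ^ i) (c i))"
    using assms unfolding polyfun_def by blast
  show ?thesis
    by (rule polyfunI[where c = "\<lambda>i. scale r (c i)"])
       (use c subspace_scale[OF assms(1)] in \<open>auto simp: scale_sum_right mult.commute\<close>)
qed

lemma polyfun_diff:
  assumes "subspace U" "polyfun U m p" "polyfun U m q"
  shows "polyfun U m (\<lambda>a. p a - q a)"
  using polyfun_add[OF assms(1,2) polyfun_scale[OF assms(1,3), of "-1"]] by simp

lemma polyfun_sum:
  assumes "subspace U" "\<And>j. j \<in> J \<Longrightarrow> polyfun U m (p j)"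
  shows "polyfun U m (\<lambda>a. \<Sum>j\<in>J. p j a)"
  using assms(2)
proof (induction J rule: infinite_finite_induct)
  case (insert j J)
  then show ?case by (simp add: polyfun_add[OF assms(1)])
\<comment> \<open>The empty and the infinite index set both give the zero function, with zero
  coefficients.\<close>
qed (use subspace_0[OF assms(1)] in \<open>auto intro!: polyfunI[where c = "\<lambda>_. 0"]\<close>)

lemma polyfun_mult_var:
  assumes "subspace U" "polyfun U m p"
  shows "polyfun U (Suc m) (\<lambda>a. scale a (p a))"
proof -
  obtain c where c: "\<forall>i<m. c i \<in> U" "\<forall>a. p a = (\<Sum>i<m. scale (a ^ i) (c i))"
    using assms unfolding polyfun_def by blast
  show ?thesis
  proof (rule polyfunI[where c = "\<lambda>i. case i of 0 \<Rightarrow> 0 | Suc j \<Rightarrow> c j"])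
    fix a
    show "scale a (p a) = (\<Sum>i<Suc m. scale (a ^ i) (case i of 0 \<Rightarrow> 0 | Suc j \<Rightarrow> c j))"
      using c by (subst sum.lessThan_Suc_shift) (simp add: scale_sum_right)
  qed (use c subspace_0[OF assms(1)] in \<open>auto split: nat.split\<close>)
qed

lemma polyfun_mult_power:
  assumes "subspace U" "polyfun U m p"
  shows "polyfun U (m + i) (\<lambda>a. scale (a ^ i) (p a))"
proof (induction i)
  case (Suc i)
  then show ?case using polyfun_mult_var[OF assms(1) Suc] by simp
qed (use assms in simp)

lemma polyfun_mult_linear:
  assumes "subspace U" "polyfun U m p"
  shows "polyfun U (Suc m) (\<lambda>a. scale (b - a) (p a))"
proof -
  have "polyfun U (Suc m) (\<lambda>a. scale b (p a) - scale a (p a))"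
    by (intro polyfun_diff polyfun_mult_var polyfun_mono[OF assms(1) polyfun_scale[OF assms]] assms)
      simp
  then show ?thesis by (simp add: scale_left_diff_distrib)
qed

lemma polyfun_mult_prod:
  assumes "subspace U" "finite K" "polyfun U m p"
  shows "polyfun U (m + card K) (\<lambda>a. scale (\<Prod>k\<in>K. g k - a) (p a))"
  using assms(2)
proof (induction K)
  case (insert k K)
  then show ?case
    using polyfun_mult_linear[OF assms(1) insert.IH, of "g k"] by simp
qed (use assms in simp)

section \<open>Factor theorem, root counting and interpolation\<close>

lemma polyfun_Suc_decompose:
  assumes "polyfun U (Suc m) p"
  shows "\<exists>c q. c \<in> U \<and> polyfun U m q \<and> (\<forall>a. p a = c + scale a (q a))"
proof -
  obtain c where c: "\<forall>i<Suc m. c i \<in> U" "\<forall>a. p a = (\<Sum>i<Suc m. scale (a ^ i) (c i))"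
    using assms unfolding polyfun_def by blast
  show ?thesis
  proof (intro exI[of _ "c 0"] exI[of _ "\<lambda>a. \<Sum>i<m. scale (a ^ i) (c (Suc i))"] conjI allI)
    show "polyfun U m (\<lambda>a. \<Sum>i<m. scale (a ^ i) (c (Suc i)))"
      by (rule polyfunI[where c = "\<lambda>i. c (Suc i)"]) (use c in auto)
    show "p a = c 0 + scale a (\<Sum>i<m. scale (a ^ i) (c (Suc i)))" for a
      using c by (simp add: sum.lessThan_Suc_shift scale_sum_right del: sum.lessThan_Suc)
  qed (use c in auto)
qed

text \<open>Horner recursion: if \<open>p a = c + a * p1 a\<close> and
  \<open>p1 a - p1 r = (a - r) * q1 a\<close>, then
  \<open>p a - p r = (a - r) * (p1 a + r * q1 a)\<close>.\<close>

lemma polyfun_factor: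
  assumes "subspace U" "polyfun U (Suc m) p"
  shows "\<exists>q. polyfun U m q \<and> (\<forall>a. p a = p r + scale (a - r) (q a))"
  using assms(2)
proof (induction m arbitrary: p)
  case 0
  obtain c q where "c \<in> U" "polyfun U 0 q" "\<forall>a. p a = c + scale a (q a)"
    using polyfun_Suc_decompose[OF 0] by blast
  then show ?case by (intro exI[of _ q]) (auto simp: polyfun_def)
next
  case (Suc m)
  obtain c p1 where p1: "c \<in> U" "polyfun U (Suc m) p1" "\<forall>a. p a = c + scale a (p1 a)"
    using polyfun_Suc_decompose[OF Suc.prems] by blast
  obtain q1 where q1: "polyfun U m q1" "\<forall>a. p1 a = p1 r + scale (a - r) (q1 a)"
    using Suc.IH[OF p1(2)] by blast
  show ?case
  proof (intro exI[of _ "\<lambda>a. p1 a + scale r (q1 a)"] conjI allI)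
    show "polyfun U (Suc m) (\<lambda>a. p1 a + scale r (q1 a))"
      by (intro polyfun_add polyfun_mono[OF assms(1) polyfun_scale[OF assms(1) q1(1)]] assms p1) simp
    fix a
    have "scale (a - r) (p1 a + scale r (q1 a)) =
        scale (a - r) (p1 a) + scale r (scale (a - r) (q1 a))"
      by (simp add: scale_right_distrib mult.commute)
    also have "scale (a - r) (q1 a) = p1 a - p1 r"
      using q1(2) by (metis add_diff_cancel_left')
    finally show "p a = p r + scale (a - r) (p1 a + scale r (q1 a))"
      by (simp add: p1(3) scale_left_diff_distrib scale_right_diff_distrib)
  qed
qed

text \<open>A root \<open>r\<close> is split off by the factor theorem. At every other root
  \<open>a\<close> the scalar \<open>a - r\<close> is invertible, so the quotient vanishes there,
  and the induction continues with one root and one coefficient fewer.\<close>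

lemma polyfun_eq_0:
  assumes "polyfun UNIV m p" "finite A" "m \<le> card A" "\<And>a. a \<in> A \<Longrightarrow> p a = 0"
  shows "p b = 0"
  using assms
proof (induction m arbitrary: p A)
  case 0
  then show ?case by (auto simp: polyfun_def)
next
  case (Suc m)
  then obtain r where r: "r \<in> A" by (metis card.empty ex_in_conv not_less_eq_eq le0)
  obtain q where q: "polyfun UNIV m q" "\<forall>a. p a = p r + scale (a - r) (q a)"
    using polyfun_factor[OF subspace_UNIV Suc.prems(1)] by blast
  have "q b = 0"
  proof (rule Suc.IH[OF q(1), of "A - {r}"])
    show "m \<le> card (A - {r})" using Suc.prems r by simp
    fix a assume "a \<in> A - {r}"
    then show "q a = 0"
      using q(2)[rule_format, of a] Suc.prems(4)[of a] Suc.prems(4)[OF r] by simp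
  qed (use Suc.prems in simp)
  then show ?case using q(2)[rule_format, of b] Suc.prems(4)[OF r] by simp
qed

text \<open>Newton interpolation: a multiple of the product over the old nodes corrects the value at
  the new node \<open>b\<close> without disturbing the old ones.\<close>

lemma polyfun_interpolation:
  assumes "subspace U" "finite A" "\<And>a. a \<in> A \<Longrightarrow> y a \<in> U"
  shows "\<exists>p. polyfun U (card A) p \<and> (\<forall>a\<in>A. p a = y a)"
  using assms(2,3)
proof (induction A)
  case empty
  then show ?case by (auto simp: polyfun_def)
next
  case (insert b A)
  then obtain p where p: "polyfun U (card A) p" "\<forall>a\<in>A. p a = y a" by auto
  define D where "D = (\<lambda>a. \<Prod>k\<in>A. k - a)"
  \<comment> \<open>Chosen so that the correction at \<open>b\<close> is the missing amount
    \<open>y b - p b\<close>; \<open>D b\<close> is invertible because \<open>b\<close> is not among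
    the old nodes.\<close>
  define w where "w = scale (1 / D b) (y b - p b)"
  have D: "D b \<noteq> 0" "\<And>a. a \<in> A \<Longrightarrow> D a = 0"
    unfolding D_def using insert.hyps by auto
  have w: "w \<in> U"
    unfolding w_def using insert.prems polyfun_in[OF assms(1) p(1)]
    by (intro subspace_scale subspace_diff assms(1)) auto
  show ?case
  proof (intro exI[of _ "\<lambda>a. p a + scale (D a) w"] conjI ballI)
    have "polyfun U (Suc 0 + card A) (\<lambda>a. scale (D a) w)"
      unfolding D_def by (intro polyfun_mult_prod polyfun_const assms insert.hyps w)
    then show "polyfun U (card (insert b A)) (\<lambda>a. p a + scale (D a) w)"
      using insert.hyps by (intro polyfun_add polyfun_mono[OF assms(1) p(1)] assms) auto
    fix a assume "a \<in> insert b A"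
    then show "p a + scale (D a) w = y a"
      using D p(2) insert.hyps by (auto simp: w_def)
  qed
qed

text \<open>Each generator multiplies the size at most by the number of scalars. Finiteness of the
  spaces \<open>V n\<close> is what makes counting noise vectors possible.\<close>

lemma finite_span:
  assumes "finite (UNIV :: 'a set)" "finite C"
  shows "finite (span C)"
  using assms(2)
proof (induction C)
  case (insert a C)
  have "span (insert a C) \<subseteq> (\<lambda>(k, y). y + scale k a) ` (UNIV \<times> span C)"
    unfolding span_insert
  proof
    fix x assume "x \<in> {x. \<exists>k. x - scale k a \<in> span C}"
    then obtain k where "x - scale k a \<in> span C" by blast
    then show "x \<in> (\<lambda>(k, y). y + scale k a) ` (UNIV \<times> span C)"
      by (intro image_eqI[of _ _ "(k, x - scale k a)"]) auto
  qed
  then show ?case using insert.IH assms(1) finite_subset by blast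
qed simp

end

section \<open>Multilinear maps\<close>

locale multilinear =
  VV: coefficient_space scaleV + WW: coefficient_space scaleW
  for scaleV :: "'q::field \<Rightarrow> 'v::ab_group_add \<Rightarrow> 'v"
    and scaleW :: "'q \<Rightarrow> 'w::ab_group_add \<Rightarrow> 'w" +
  fixes N :: nat and V :: "nat \<Rightarrow> 'v set" and \<Omega> :: "(nat \<Rightarrow> 'v) \<Rightarrow> 'w"
  assumes subspace_V: "n \<in> {1..N} \<Longrightarrow> VV.subspace (V n)"
    and multilinear_map: "multilinear_map scaleV scaleW N V \<Omega>"
begin

lemma
  assumes "n \<in> {1..N}" "v \<in> (\<Pi>\<^sub>E i\<in>{1..N}. V i)" "a \<in> V n"
  shows multilinear_add: "b \<in> V n \<Longrightarrow> \<Omega> (v(n := a + b)) = \<Omega> (v(n := a)) + \<Omega> (v(n := b))"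
    and multilinear_scale: "\<Omega> (v(n := scaleV r a)) = scaleW r (\<Omega> (v(n := a)))"
  using multilinear_map assms unfolding multilinear_map_def by blast+

lemma multilinear_sum:
  assumes "n \<in> {1..N}" "v \<in> (\<Pi>\<^sub>E i\<in>{1..N}. V i)" "finite J" "\<And>j. j \<in> J \<Longrightarrow> c j \<in> V n"
  shows "\<Omega> (v(n := \<Sum>j\<in>J. scaleV (r j) (c j))) = (\<Sum>j\<in>J. scaleW (r j) (\<Omega> (v(n := c j))))"
  using assms(3,4)
proof (induction J)
  case empty
  have "\<Omega> (v(n := scaleV 0 0)) = scaleW 0 (\<Omega> (v(n := 0)))"
    by (intro multilinear_scale assms VV.subspace_0 subspace_V)
  then show ?case unfolding VV.scale_zero_left WW.scale_zero_left sum.empty .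
next
  case (insert j J)
  have "(\<Sum>j\<in>J. scaleV (r j) (c j)) \<in> V n" "scaleV (r j) (c j) \<in> V n" "c j \<in> V n"
    using insert.prems
    by (auto intro!: VV.subspace_sum VV.subspace_scale subspace_V[OF assms(1)])
  then have "\<Omega> (v(n := scaleV (r j) (c j) + (\<Sum>j\<in>J. scaleV (r j) (c j)))) =
      scaleW (r j) (\<Omega> (v(n := c j))) + \<Omega> (v(n := \<Sum>j\<in>J. scaleV (r j) (c j)))"
    by (simp only: multilinear_add[OF assms(1,2)] multilinear_scale[OF assms(1,2)])
  moreover have "\<Omega> (v(n := \<Sum>j\<in>J. scaleV (r j) (c j))) = (\<Sum>j\<in>J. scaleW (r j) (\<Omega> (v(n := c j))))"
    using insert.prems by (intro insert.IH) simp
  ultimately show ?case unfolding sum.insert[OF insert.hyps] by (rule trans[OF _ arg_cong])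
qed

text \<open>Each of the \<open>N\<close> arguments contributes one factor \<open>r\<close>; the
  induction counts the arguments already scaled.\<close>

lemma multilinear_scale_all:
  assumes "\<And>n. n \<in> {1..N} \<Longrightarrow> v n \<in> V n"
  shows "\<Omega> (\<lambda>n\<in>{1..N}. scaleV r (v n)) = scaleW (r ^ N) (\<Omega> (\<lambda>n\<in>{1..N}. v n))"
proof -
  have "\<Omega> (\<lambda>n\<in>{1..N}. if n \<le> m then scaleV r (v n) else v n) =
      scaleW (r ^ m) (\<Omega> (\<lambda>n\<in>{1..N}. v n))" if "m \<le> N" for m
    using that
  proof (induction m)
    case 0
    have "(\<lambda>n\<in>{1..N}. if n \<le> 0 then scaleV r (v n) else v n) = (\<lambda>n\<in>{1..N}. v n)" by auto
    then show ?case by simp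
  next
    case (Suc m)
    define w where "w = (\<lambda>n\<in>{1..N}. if n \<le> m then scaleV r (v n) else v n)"
    have w: "w \<in> (\<Pi>\<^sub>E i\<in>{1..N}. V i)"
      unfolding w_def using assms by (auto intro!: VV.subspace_scale subspace_V)
    have s1: "(\<lambda>n\<in>{1..N}. if n \<le> Suc m then scaleV r (v n) else v n) =
        w(Suc m := scaleV r (v (Suc m)))"
      using Suc.prems by (auto simp: w_def fun_eq_iff)
    have s2: "\<Omega> (w(Suc m := scaleV r (v (Suc m)))) = scaleW r (\<Omega> (w(Suc m := v (Suc m))))"
      using Suc.prems by (intro multilinear_scale w assms) auto
    have s3: "w(Suc m := v (Suc m)) = w"
      using Suc.prems by (auto simp: w_def fun_eq_iff)
    have s4: "\<Omega> w = scaleW (r ^ m) (\<Omega> (\<lambda>n\<in>{1..N}. v n))"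
      unfolding w_def using Suc.prems by (intro Suc.IH) simp
    show ?case unfolding s1 s2 s3 s4 by (simp only: WW.scale_scale power_Suc)
  qed
  note this[of N]
  moreover have "(\<lambda>n\<in>{1..N}. if n \<le> N then scaleV r (v n) else v n) = (\<lambda>n\<in>{1..N}. scaleV r (v n))"
    by auto
  ultimately show ?thesis by simp
qed

text \<open>Degrees add up over the arguments: expanding one argument into its coefficients costs at
  most \<open>d\<close> further powers of \<open>a\<close>.\<close>

lemma polyfun_multilinear:
  assumes "\<And>n. n \<in> {1..N} \<Longrightarrow> VV.polyfun (V n) (Suc d) (p n)"
  shows "WW.polyfun UNIV (Suc (N * d)) (\<lambda>a. \<Omega> (\<lambda>n\<in>{1..N}. p n a))"
proof -
  \<comment> \<open>The first \<open>m\<close> arguments are polynomials, the others constants.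
    \<open>v\<close> stays arbitrary because the induction step puts each coefficient
    \<open>c i\<close> of the next polynomial into the constant slot \<open>Suc m\<close>.\<close>
  have "WW.polyfun UNIV (Suc (m * d)) (\<lambda>a. \<Omega> (\<lambda>n\<in>{1..N}. if n \<le> m then p n a else v n))"
    if "m \<le> N" "\<And>n. n \<in> {1..N} \<Longrightarrow> v n \<in> V n" for m v
    using that
  proof (induction m arbitrary: v)
    case 0
    have "(\<lambda>n\<in>{1..N}. if n \<le> 0 then p n a else v n) = (\<lambda>n\<in>{1..N}. v n)" for a by auto
    then show ?case by (simp add: WW.polyfun_const)
  next
    case (Suc m)
    have Sm: "Suc m \<in> {1..N}" using Suc.prems by simp
    obtain c where c: "\<forall>i<Suc d. c i \<in> V (Suc m)"
      "\<forall>a. p (Suc m) a = (\<Sum>i<Suc d. scaleV (a ^ i) (c i))"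
      using assms[OF Sm] unfolding VV.polyfun_def by blast
    let ?w = "\<lambda>i a. \<lambda>n\<in>{1..N}. if n \<le> m then p n a else (v(Suc m := c i)) n"
    have eq: "\<Omega> (\<lambda>n\<in>{1..N}. if n \<le> Suc m then p n a else v n) =
        (\<Sum>i<Suc d. scaleW (a ^ i) (\<Omega> (?w i a)))" for a
    proof -
      define u where "u = (\<lambda>n\<in>{1..N}. if n \<le> m then p n a else v n)"
      have u: "u \<in> (\<Pi>\<^sub>E i\<in>{1..N}. V i)"
        unfolding u_def using Suc.prems(2) VV.polyfun_in[OF subspace_V assms] by auto
      have "(\<lambda>n\<in>{1..N}. if n \<le> Suc m then p n a else v n) =
          u(Suc m := \<Sum>i<Suc d. scaleV (a ^ i) (c i))"
        using Sm c(2) by (auto simp: u_def fun_eq_iff simp del: sum.lessThan_Suc)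
      moreover have "u(Suc m := c i) = ?w i a" for i
        using Sm by (auto simp: u_def fun_eq_iff)
      moreover have "\<Omega> (u(Suc m := \<Sum>i<Suc d. scaleV (a ^ i) (c i))) =
          (\<Sum>i<Suc d. scaleW (a ^ i) (\<Omega> (u(Suc m := c i))))"
        using c(1) by (intro multilinear_sum Sm u) auto
      ultimately show ?thesis by (simp only:)
    qed
    have "WW.polyfun UNIV (Suc (Suc m * d)) (\<lambda>a. scaleW (a ^ i) (\<Omega> (?w i a)))" if "i < Suc d" for i
    proof -
      have "WW.polyfun UNIV (Suc (m * d) + i) (\<lambda>a. scaleW (a ^ i) (\<Omega> (?w i a)))"
        using Suc.prems c(1) that
        by (intro WW.polyfun_mult_power Suc.IH) auto
      \<comment> \<open>Since \<open>i \<le> d\<close>, the bound \<open>Suc (m * d) + i\<close>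
        stays within \<open>Suc (Suc m * d)\<close>.\<close>
      then show ?thesis
        by (rule WW.polyfun_mono[rotated]) (use that in auto)
    qed
    then show ?case
      unfolding eq by (intro WW.polyfun_sum) auto
  qed
  \<comment> \<open>For \<open>m = N\<close> no constant slot remains, so 0 serves as a filler that
    lies in every \<open>V n\<close>.\<close>
  from this[of N "\<lambda>_. 0"]
  have "WW.polyfun UNIV (Suc (N * d)) (\<lambda>a. \<Omega> (\<lambda>n\<in>{1..N}. if n \<le> N then p n a else 0))"
    using VV.subspace_0[OF subspace_V] by simp
  moreover have "(\<lambda>n\<in>{1..N}. if n \<le> N then p n a else 0) = (\<lambda>n\<in>{1..N}. p n a)" for a
    by auto
  ultimately show ?thesis by simp
qed

end

section \<open>Decoding\<close>

locale csa_code = multilinear scaleV scaleW N V \<Omega>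
  for scaleV :: "'q::field \<Rightarrow> 'v::ab_group_add \<Rightarrow> 'v"
    and scaleW :: "'q \<Rightarrow> 'w::ab_group_add \<Rightarrow> 'w"
    and N :: nat and V :: "nat \<Rightarrow> 'v set" and \<Omega> :: "(nat \<Rightarrow> 'v) \<Rightarrow> 'w" +
  fixes S ell Kc X :: nat and f :: "nat \<Rightarrow> nat \<Rightarrow> 'q" and \<alpha> :: "nat \<Rightarrow> 'q"
  assumes Kc: "Kc \<ge> 1" and points: "csa_points ell Kc S f \<alpha>"
begin

section \<open>Evaluation points and the share polynomial\<close>

lemma f_eq_iff:
  "l \<in> {1..ell} \<Longrightarrow> k \<in> {1..Kc} \<Longrightarrow> l' \<in> {1..ell} \<Longrightarrow> k' \<in> {1..Kc} \<Longrightarrow>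
    f l k = f l' k' \<longleftrightarrow> l = l' \<and> k = k'"
  using points inj_on_eq_iff[of "\<lambda>(l, k). f l k" "{1..ell} \<times> {1..Kc}" "(l, k)" "(l', k')"]
  unfolding csa_points_def by (simp del: atLeastAtMost_iff)

lemma f_neq_\<alpha>: "l \<in> {1..ell} \<Longrightarrow> k \<in> {1..Kc} \<Longrightarrow> s \<in> {1..S} \<Longrightarrow> f l k \<noteq> \<alpha> s"
  using points unfolding csa_points_def by blast

lemma inj_on_\<alpha>: "inj_on \<alpha> {1..S}"
  using points unfolding csa_points_def by blast

text \<open>The share with denominators cleared: the factor with index \<open>k\<close> of
  \<open>csa_Delta\<close> has cancelled \<open>1 / (f l k - a)\<close>. In this form it can also be
  evaluated at the points \<open>f l k\<close>.\<close>

definition share_poly :: "(nat \<Rightarrow> 'v) \<Rightarrow> (nat \<Rightarrow> nat \<Rightarrow> nat \<Rightarrow> 'v) \<Rightarrow> nat \<Rightarrow> 'q \<Rightarrow> 'v" where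
  "share_poly x z l a =
    (\<Sum>k\<in>{1..Kc}. scaleV (\<Prod>j\<in>{1..Kc} - {k}. f l j - a) (x (Kc * (l - 1) + k)) +
       scaleV (\<Prod>j\<in>{1..Kc}. f l j - a) (\<Sum>t\<in>{1..X}. scaleV (a ^ (t - 1)) (z l k t)))"

lemma csa_share_eq_share_poly:
  assumes "s \<in> {1..S}" "l \<in> {1..ell}"
  shows "csa_share scaleV Kc X f \<alpha> x z s l = share_poly x z l (\<alpha> s)"
  unfolding csa_share_def share_poly_def VV.scale_sum_right[of "csa_Delta Kc f \<alpha> s l"]
proof (rule sum.cong[OF refl])
  fix k assume k: "k \<in> {1..Kc}"
  have "csa_Delta Kc f \<alpha> s l = (f l k - \<alpha> s) * (\<Prod>j\<in>{1..Kc} - {k}. f l j - \<alpha> s)"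
    unfolding csa_Delta_def using k by (intro prod.remove) auto
  moreover have "f l k - \<alpha> s \<noteq> 0" using f_neq_\<alpha>[OF assms(2) k assms(1)] by simp
  ultimately have "csa_Delta Kc f \<alpha> s l * (1 / (f l k - \<alpha> s)) = (\<Prod>j\<in>{1..Kc} - {k}. f l j - \<alpha> s)"
    by simp
  then show "scaleV (csa_Delta Kc f \<alpha> s l)
      (scaleV (1 / (f l k - \<alpha> s)) (x (Kc * (l - 1) + k)) + (\<Sum>t\<in>{1..X}. scaleV (\<alpha> s ^ (t - 1)) (z l k t))) =
    scaleV (\<Prod>j\<in>{1..Kc} - {k}. f l j - \<alpha> s) (x (Kc * (l - 1) + k)) +
      scaleV (\<Prod>j\<in>{1..Kc}. f l j - \<alpha> s) (\<Sum>t\<in>{1..X}. scaleV (\<alpha> s ^ (t - 1)) (z l k t))"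
    unfolding VV.scale_right_distrib VV.scale_scale by (simp only: csa_Delta_def)
qed

text \<open>At \<open>f l k\<close> the full product kills all noise, and the product without index
  \<open>i\<close> kills every data term with \<open>i \<noteq> k\<close>, as it still contains the
  factor with index \<open>k\<close>.\<close>

lemma share_poly_at_pole:
  assumes "k \<in> {1..Kc}"
  shows "share_poly x z l (f l k) =
    scaleV (\<Prod>j\<in>{1..Kc} - {k}. f l j - f l k) (x (Kc * (l - 1) + k))"
proof -
  have 0: "(\<Prod>j\<in>{1..Kc}. f l j - f l k) = 0" using assms by (intro prod_zero) auto
  have "(\<Prod>j\<in>{1..Kc} - {i}. f l j - f l k) = 0" if "i \<noteq> k" for i
    using assms that by (intro prod_zero) auto
  then have "share_poly x z l (f l k) =
      (\<Sum>i\<in>{1..Kc}. if i = k then scaleV (\<Prod>j\<in>{1..Kc} - {k}. f l j - f l k) (x (Kc * (l - 1) + k)) else 0)"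
    unfolding share_poly_def 0 by (intro sum.cong) auto
  then show ?thesis using assms by simp
qed

text \<open>A data term has \<open>Kc - 1\<close> linear factors, hence at most \<open>Kc\<close>
  coefficients; a noise term has \<open>Kc\<close> linear factors times a polynomial with
  \<open>X\<close> coefficients.\<close>

lemma polyfun_share_poly:
  assumes U: "VV.subspace U"
    and x: "\<And>k. k \<in> {1..Kc} \<Longrightarrow> x (Kc * (l - 1) + k) \<in> U"
    and z: "\<And>k t. k \<in> {1..Kc} \<Longrightarrow> t \<in> {1..X} \<Longrightarrow> z l k t \<in> U"
  shows "VV.polyfun U (Kc + X) (share_poly x z l)"
proof -
  have 1: "VV.polyfun U (Kc + X) (\<lambda>a. scaleV (\<Prod>j\<in>{1..Kc} - {k}. f l j - a) (x (Kc * (l - 1) + k)))"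
    if k: "k \<in> {1..Kc}" for k
  proof (rule VV.polyfun_mono[OF U])
    show "VV.polyfun U (Suc 0 + card ({1..Kc} - {k}))
      (\<lambda>a. scaleV (\<Prod>j\<in>{1..Kc} - {k}. f l j - a) (x (Kc * (l - 1) + k)))"
      by (intro VV.polyfun_mult_prod VV.polyfun_const U x k) auto
  qed (use k in auto)
  have 2: "VV.polyfun U (Kc + X)
      (\<lambda>a. scaleV (\<Prod>j\<in>{1..Kc}. f l j - a) (\<Sum>t\<in>{1..X}. scaleV (a ^ (t - 1)) (z l k t)))"
    if k: "k \<in> {1..Kc}" for k
  proof -
    have "VV.polyfun U X (\<lambda>a. scaleV (a ^ (t - 1)) (z l k t))" if t: "t \<in> {1..X}" for t
    proof (rule VV.polyfun_mono[OF U])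
      show "VV.polyfun U (Suc 0 + (t - 1)) (\<lambda>a. scaleV (a ^ (t - 1)) (z l k t))"
        by (intro VV.polyfun_mult_power VV.polyfun_const U z k t)
    qed (use t in auto)
    then have "VV.polyfun U (X + card {1..Kc})
      (\<lambda>a. scaleV (\<Prod>j\<in>{1..Kc}. f l j - a) (\<Sum>t\<in>{1..X}. scaleV (a ^ (t - 1)) (z l k t)))"
      by (intro VV.polyfun_mult_prod VV.polyfun_sum U) auto
    then show ?thesis by (simp add: add.commute)
  qed
  show ?thesis
    unfolding share_poly_def by (intro VV.polyfun_sum VV.polyfun_add U 1 2)
qed

section \<open>The answer polynomial at servers and at poles\<close>

text \<open>The answer times \<open>csa_Delta\<close> of all blocks: dividing by that of block
  \<open>l\<close> leaves the factors of the other blocks. A single product over index pairs suits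
  \<open>polyfun_mult_prod\<close>.\<close>

definition answer_poly ::
  "(nat \<Rightarrow> nat \<Rightarrow> 'v) \<Rightarrow> (nat \<Rightarrow> nat \<Rightarrow> nat \<Rightarrow> nat \<Rightarrow> 'v) \<Rightarrow> 'q \<Rightarrow> 'w" where
  "answer_poly x z a =
    (\<Sum>l\<in>{1..ell}. scaleW (\<Prod>p\<in>({1..ell} - {l}) \<times> {1..Kc}. f (fst p) (snd p) - a)
       (\<Omega> (\<lambda>n\<in>{1..N}. share_poly (x n) (z n) l a)))"

definition valid_input :: "(nat \<Rightarrow> nat \<Rightarrow> 'v) \<Rightarrow> (nat \<Rightarrow> nat \<Rightarrow> nat \<Rightarrow> nat \<Rightarrow> 'v) \<Rightarrow> bool" where
  "valid_input x z \<longleftrightarrow> (\<forall>n\<in>{1..N}. \<forall>l\<in>{1..ell * Kc}. x n l \<in> V n) \<and>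
     (\<forall>n\<in>{1..N}. \<forall>l\<in>{1..ell}. \<forall>k\<in>{1..Kc}. \<forall>t\<in>{1..X}. z n l k t \<in> V n)"

lemma block_index_in:
  assumes "l \<in> {1..ell}" "k \<in> {1..Kc}"
  shows "Kc * (l - 1) + k \<in> {1..ell * Kc}"
proof -
  have "Kc * (l - 1) + k \<le> Kc * (l - 1) + Kc" using assms by simp
  also have "\<dots> = Kc * l" using assms by (cases l) auto
  also have "\<dots> \<le> ell * Kc" using assms by (simp add: mult.commute)
  finally show ?thesis using assms by simp
qed

text \<open>Degree \<open>N * (Kc + X - 1)\<close> comes from the share polynomials inside
  \<open>\<Omega>\<close> and \<open>(ell - 1) * Kc\<close> from the linear factors of the other
  blocks. With the leading \<open>Suc\<close> this is the recovery threshold minus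
  \<open>2 * B\<close>.\<close>

lemma polyfun_answer_poly:
  assumes "valid_input x z"
  shows "WW.polyfun UNIV (Suc (N * (Kc + X - 1) + (ell - 1) * Kc)) (answer_poly x z)"
proof -
  have "WW.polyfun UNIV (Suc (N * (Kc + X - 1)) + card (({1..ell} - {l}) \<times> {1..Kc}))
      (\<lambda>a. scaleW (\<Prod>p\<in>({1..ell} - {l}) \<times> {1..Kc}. f (fst p) (snd p) - a)
         (\<Omega> (\<lambda>n\<in>{1..N}. share_poly (x n) (z n) l a)))" if l: "l \<in> {1..ell}" for l
  proof (intro WW.polyfun_mult_prod polyfun_multilinear)
    fix n assume n: "n \<in> {1..N}"
    have "VV.polyfun (V n) (Kc + X) (share_poly (x n) (z n) l)"
      using assms n l block_index_in[OF l] unfolding valid_input_def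
      by (intro polyfun_share_poly subspace_V) blast+
    \<comment> \<open>\<open>Kc \<ge> 1\<close> keeps the natural subtraction exact, even for
      \<open>X = 0\<close>.\<close>
    then show "VV.polyfun (V n) (Suc (Kc + X - 1)) (share_poly (x n) (z n) l)"
      using Kc by simp
  qed auto
  moreover have "Suc (N * (Kc + X - 1)) + card (({1..ell} - {l}) \<times> {1..Kc}) =
      Suc (N * (Kc + X - 1) + (ell - 1) * Kc)" if "l \<in> {1..ell}" for l
    using that by (simp add: card_cartesian_product)
  ultimately show ?thesis
    unfolding answer_poly_def by (intro WW.polyfun_sum) auto
qed

lemma answer_poly_at_server:
  assumes s: "s \<in> {1..S}"
  shows "answer_poly x z (\<alpha> s) = scaleW (\<Prod>l\<in>{1..ell}. csa_Delta Kc f \<alpha> s l)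
    (csa_answer scaleV scaleW N ell Kc X \<Omega> f \<alpha> x z s)"
  unfolding answer_poly_def csa_answer_def WW.scale_sum_right
proof (rule sum.cong[OF refl])
  fix l assume l: "l \<in> {1..ell}"
  have "(\<Prod>p\<in>({1..ell} - {l}) \<times> {1..Kc}. f (fst p) (snd p) - \<alpha> s) =
      (\<Prod>l'\<in>{1..ell} - {l}. csa_Delta Kc f \<alpha> s l')"
    unfolding csa_Delta_def prod.cartesian_product by (simp add: case_prod_unfold)
  moreover have "(\<Prod>l'\<in>{1..ell}. csa_Delta Kc f \<alpha> s l') =
      csa_Delta Kc f \<alpha> s l * (\<Prod>l'\<in>{1..ell} - {l}. csa_Delta Kc f \<alpha> s l')"
    using l by (intro prod.remove) auto
  \<comment> \<open>No \<open>\<alpha> s\<close> equals an \<open>f l k\<close>, so block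
    \<open>l\<close> can be divided out of the product.\<close>
  moreover have "csa_Delta Kc f \<alpha> s l \<noteq> 0"
    unfolding csa_Delta_def using f_neq_\<alpha>[OF l _ s] by auto
  ultimately have 1: "(\<Prod>p\<in>({1..ell} - {l}) \<times> {1..Kc}. f (fst p) (snd p) - \<alpha> s) =
      (\<Prod>l'\<in>{1..ell}. csa_Delta Kc f \<alpha> s l') * (1 / csa_Delta Kc f \<alpha> s l)"
    by simp
  show "scaleW (\<Prod>p\<in>({1..ell} - {l}) \<times> {1..Kc}. f (fst p) (snd p) - \<alpha> s)
      (\<Omega> (\<lambda>n\<in>{1..N}. share_poly (x n) (z n) l (\<alpha> s))) =
    scaleW (\<Prod>l'\<in>{1..ell}. csa_Delta Kc f \<alpha> s l') (scaleW (1 / csa_Delta Kc f \<alpha> s l)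
      (\<Omega> (\<lambda>n\<in>{1..N}. csa_share scaleV Kc X f \<alpha> (x n) (z n) s l)))"
    unfolding 1 WW.scale_scale csa_share_eq_share_poly[OF s l] ..
qed

text \<open>Only block \<open>l\<close> survives at \<open>f l k\<close>, where each argument of
  \<open>\<Omega>\<close> is a multiple of the data vector. The constant depends on the points and
  not on \<open>x\<close> or \<open>z\<close>, which allows two inputs to be compared.\<close>

lemma answer_poly_at_pole:
  assumes l: "l \<in> {1..ell}" and k: "k \<in> {1..Kc}"
  shows "\<exists>c. c \<noteq> 0 \<and> (\<forall>x z. valid_input x z \<longrightarrow>
    answer_poly x z (f l k) = scaleW c (\<Omega> (\<lambda>n\<in>{1..N}. x n (Kc * (l - 1) + k))))"
proof -
  define r where "r = (\<Prod>j\<in>{1..Kc} - {k}. f l j - f l k)"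
  define c where "c = (\<Prod>p\<in>({1..ell} - {l}) \<times> {1..Kc}. f (fst p) (snd p) - f l k)"
  have "r \<noteq> 0" unfolding r_def using f_eq_iff[OF l _ l k] by auto
  moreover have "c \<noteq> 0" unfolding c_def using f_eq_iff[OF _ _ l k] by auto
  \<comment> \<open>\<open>c\<close> collects the factors of the other blocks, and each of the
    \<open>N\<close> arguments contributes one \<open>r\<close>; both are nonzero because the points
    \<open>f l k\<close> are distinct.\<close>
  moreover have "answer_poly x z (f l k) = scaleW (c * r ^ N) (\<Omega> (\<lambda>n\<in>{1..N}. x n (Kc * (l - 1) + k)))"
    if "valid_input x z" for x z
  proof -
    \<comment> \<open>For \<open>l' \<noteq> l\<close> the pair \<open>(l, k)\<close> is an index of
      the product and contributes the factor zero.\<close>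
    have "(\<Prod>p\<in>({1..ell} - {l'}) \<times> {1..Kc}. f (fst p) (snd p) - f l k) = 0" if "l' \<noteq> l" for l'
      using that l k by (intro prod_zero bexI[of _ "(l, k)"]) auto
    then have "answer_poly x z (f l k) = (\<Sum>l'\<in>{1..ell}. if l' = l
        then scaleW c (\<Omega> (\<lambda>n\<in>{1..N}. share_poly (x n) (z n) l (f l k))) else 0)"
      unfolding answer_poly_def c_def by (intro sum.cong) auto
    also have "\<dots> = scaleW c (\<Omega> (\<lambda>n\<in>{1..N}. share_poly (x n) (z n) l (f l k)))"
      using l by simp
    also have "\<dots> = scaleW c (\<Omega> (\<lambda>n\<in>{1..N}. scaleV r (x n (Kc * (l - 1) + k))))"
      unfolding share_poly_at_pole[OF k] r_def ..
    also have "\<dots> = scaleW (c * r ^ N) (\<Omega> (\<lambda>n\<in>{1..N}. x n (Kc * (l - 1) + k)))"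
    proof -
      have "\<Omega> (\<lambda>n\<in>{1..N}. scaleV r (x n (Kc * (l - 1) + k))) =
          scaleW (r ^ N) (\<Omega> (\<lambda>n\<in>{1..N}. x n (Kc * (l - 1) + k)))"
        using that block_index_in[OF l k] unfolding valid_input_def
        by (intro multilinear_scale_all) blast
      then show ?thesis by (simp only: WW.scale_scale)
    qed
    finally show ?thesis .
  qed
  ultimately show ?thesis by (intro exI[of _ "c * r ^ N"]) auto
qed

section \<open>Uniqueness of the output and error correction\<close>

text \<open>Two answer polynomials agreeing at more points than their degree bound coincide
  everywhere. At the point \<open>f l k\<close> belonging to index \<open>i\<close> they are the
  same nonzero multiple of the two outputs.\<close>

lemma answers_determine_output:
  assumes "valid_input x z" "valid_input x' z'"
    and "A \<subseteq> {1..S}" "N * (Kc + X - 1) + (ell - 1) * Kc < card A"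
    and "\<And>s. s \<in> A \<Longrightarrow> csa_answer scaleV scaleW N ell Kc X \<Omega> f \<alpha> x z s =
      csa_answer scaleV scaleW N ell Kc X \<Omega> f \<alpha> x' z' s"
    and i: "i \<in> {1..ell * Kc}"
  shows "\<Omega> (\<lambda>n\<in>{1..N}. x n i) = \<Omega> (\<lambda>n\<in>{1..N}. x' n i)"
proof -
  \<comment> \<open>Indices start at 1, so quotient and remainder are taken of \<open>i - 1\<close>,
    inverting \<open>i = Kc * (l - 1) + k\<close>.\<close>
  define l where "l = Suc ((i - 1) div Kc)"
  define k where "k = Suc ((i - 1) mod Kc)"
  have "(i - 1) div Kc < ell" using i by (intro less_mult_imp_div_less) auto
  then have l: "l \<in> {1..ell}" unfolding l_def by simp
  have k: "k \<in> {1..Kc}" unfolding k_def using Kc by (simp add: Suc_le_eq)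
  have ix: "Kc * (l - 1) + k = i" unfolding l_def k_def using i by simp
  obtain c where c: "c \<noteq> 0" "\<And>x z. valid_input x z \<Longrightarrow>
      answer_poly x z (f l k) = scaleW c (\<Omega> (\<lambda>n\<in>{1..N}. x n i))"
    using answer_poly_at_pole[OF l k] unfolding ix by blast
  have inj: "inj_on \<alpha> A" using inj_on_\<alpha> assms(3) by (rule inj_on_subset)
  have "answer_poly x z (f l k) - answer_poly x' z' (f l k) = 0"
  proof (rule WW.polyfun_eq_0)
    show "WW.polyfun UNIV (Suc (N * (Kc + X - 1) + (ell - 1) * Kc))
        (\<lambda>a. answer_poly x z a - answer_poly x' z' a)"
      by (intro WW.polyfun_diff polyfun_answer_poly assms WW.subspace_UNIV)
    show "finite (\<alpha> ` A)" using assms(3) finite_subset by auto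
    show "Suc (N * (Kc + X - 1) + (ell - 1) * Kc) \<le> card (\<alpha> ` A)"
      using assms(4) card_image[OF inj] by simp
    fix a assume "a \<in> \<alpha> ` A"
    then obtain s where s: "s \<in> A" "a = \<alpha> s" by auto
    then have "s \<in> {1..S}" using assms(3) by auto
    then show "answer_poly x z a - answer_poly x' z' a = 0"
      using assms(5)[OF s(1)] by (simp add: s(2) answer_poly_at_server del: atLeastAtMost_iff)
  qed
  then show ?thesis using c assms(1,2) by simp
qed

text \<open>The decoder picks any input whose answers differ from the responses in at most
  \<open>B\<close> places and returns its output; all such inputs yield the same output.\<close>

lemma byzantine_decoder:
  assumes R: "R = N * (Kc + X - 1) + (ell - 1) * Kc + 2 * B + 1"
    and \<R>: "\<R> \<subseteq> {1..S}" "card \<R> = R"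
  shows "\<exists>d \<in> (\<R> \<rightarrow>\<^sub>E UNIV) \<rightarrow> ({1..ell * Kc} \<rightarrow>\<^sub>E UNIV).
    \<forall>x z. \<forall>Y' \<in> \<R> \<rightarrow>\<^sub>E UNIV. valid_input x z \<and>
      card {s\<in>\<R>. Y' s \<noteq> csa_answer scaleV scaleW N ell Kc X \<Omega> f \<alpha> x z s} \<le> B \<longrightarrow>
      d Y' = (\<lambda>l\<in>{1..ell * Kc}. \<Omega> (\<lambda>n\<in>{1..N}. x n l))"
proof -
  let ?ans = "csa_answer scaleV scaleW N ell Kc X \<Omega> f \<alpha>"
  let ?out = "\<lambda>x. \<lambda>l\<in>{1..ell * Kc}. \<Omega> (\<lambda>n\<in>{1..N}. x n l)"
  let ?ok = "\<lambda>Y' x z. valid_input x z \<and> card {s\<in>\<R>. Y' s \<noteq> ?ans x z s} \<le> B"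
  \<comment> \<open>If no input is consistent with \<open>Y'\<close>, the choice is arbitrary, but
    the result is still extensional.\<close>
  define d where "d Y' = ?out (SOME x. \<exists>z. ?ok Y' x z)" for Y'
  have fin: "finite \<R>" using \<R>(1) finite_subset by blast
  have unique: "?out x = ?out x'" if ok: "?ok Y' x z" "?ok Y' x' z'" for Y' x z x' z'
  proof -
    define A where "A = {s\<in>\<R>. ?ans x z s = ?ans x' z' s}"
    \<comment> \<open>Where the two answer vectors disagree, at least one of them differs from the
      responses; each does so at most \<open>B\<close> times.\<close>
    have "\<R> - A \<subseteq> {s\<in>\<R>. Y' s \<noteq> ?ans x z s} \<union> {s\<in>\<R>. Y' s \<noteq> ?ans x' z' s}"
      unfolding A_def by auto
    then have "card (\<R> - A) \<le> card ({s\<in>\<R>. Y' s \<noteq> ?ans x z s} \<union> {s\<in>\<R>. Y' s \<noteq> ?ans x' z' s})"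
      using fin by (intro card_mono) auto
    also have "\<dots> \<le> 2 * B" 
      using card_Un_le[of "{s\<in>\<R>. Y' s \<noteq> ?ans x z s}" "{s\<in>\<R>. Y' s \<noteq> ?ans x' z' s}"] ok by linarith
    finally have "card (\<R> - A) \<le> 2 * B" .
    moreover have "card (\<R> - A) = card \<R> - card A"
      using fin unfolding A_def by (intro card_Diff_subset) auto
    \<comment> \<open>Removing at most \<open>2 * B\<close> of the \<open>R\<close> servers leaves
      more than the degree bound.\<close>
    ultimately have "N * (Kc + X - 1) + (ell - 1) * Kc < card A" using \<R>(2) R by linarith
    moreover have "A \<subseteq> {1..S}" using \<R>(1) unfolding A_def by blast
    ultimately show ?thesis
      using ok by (intro restrict_ext answers_determine_output[of x z x' z' A]) (simp_all only: A_def mem_Collect_eq)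
  qed
  show ?thesis
  proof (intro bexI[of _ d] allI ballI impI)
    fix x z Y' assume ok: "?ok Y' x z"
    then have "\<exists>z. ?ok Y' (SOME x. \<exists>z. ?ok Y' x z) z"
      by (intro someI[of "\<lambda>x. \<exists>z. ?ok Y' x z"] exI[of _ z])
    then obtain z' where "?ok Y' (SOME x. \<exists>z. ?ok Y' x z) z'" ..
    then show "d Y' = ?out x" unfolding d_def using ok by (rule unique)
  next
    show "d \<in> (\<R> \<rightarrow>\<^sub>E UNIV) \<rightarrow> ({1..ell * Kc} \<rightarrow>\<^sub>E UNIV)" unfolding d_def by auto
  qed
qed

end

section \<open>Security\<close>

text \<open>Mutual information is the divergence between the joint distribution and the product of
  the marginals, which coincide by \<open>indep\<close>. Finite ranges reduce equality of measures
  to singletons.\<close>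

lemma (in prob_space) mutual_information_indep_finite:
  assumes fin: "finite (U ` space M)" "finite (T ` space M)"
    and meas: "U \<in> measurable M (count_space (U ` space M))" "T \<in> measurable M (count_space (T ` space M))"
    and indep: "\<And>u t. u \<in> U ` space M \<Longrightarrow> t \<in> T ` space M \<Longrightarrow>
      prob {\<omega>\<in>space M. U \<omega> = u \<and> T \<omega> = t} = prob {\<omega>\<in>space M. U \<omega> = u} * prob {\<omega>\<in>space M. T \<omega> = t}"
  shows "mutual_information b (count_space (U ` space M)) (count_space (T ` space M)) U T = 0"
proof -
  let ?S = "count_space (U ` space M)" and ?S' = "count_space (T ` space M)"
  interpret P: prob_space "distr M ?S U" by (rule prob_space_distr) fact
  interpret Q: prob_space "distr M ?S' T" by (rule prob_space_distr) fact
  interpret PQ: pair_prob_space "distr M ?S U" "distr M ?S' T" ..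
  have prod: "?S \<Otimes>\<^sub>M ?S' = count_space (U ` space M \<times> T ` space M)"
    by (rule pair_measure_count_space) fact+
  have pair: "(\<lambda>\<omega>. (U \<omega>, T \<omega>)) \<in> measurable M (?S \<Otimes>\<^sub>M ?S')"
    using meas by (rule measurable_Pair)
  have "distr M (?S \<Otimes>\<^sub>M ?S') (\<lambda>\<omega>. (U \<omega>, T \<omega>)) = distr M ?S U \<Otimes>\<^sub>M distr M ?S' T"
  proof (rule measure_eqI_finite)
    show "sets (distr M (?S \<Otimes>\<^sub>M ?S') (\<lambda>\<omega>. (U \<omega>, T \<omega>))) = Pow (U ` space M \<times> T ` space M)"
      unfolding prod by simp
    have "sets (distr M ?S U \<Otimes>\<^sub>M distr M ?S' T) = sets (?S \<Otimes>\<^sub>M ?S')"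
      by (intro sets_pair_measure_cong) simp_all
    then show "sets (distr M ?S U \<Otimes>\<^sub>M distr M ?S' T) = Pow (U ` space M \<times> T ` space M)"
      unfolding prod by simp
    show "finite (U ` space M \<times> T ` space M)" using fin by simp
    fix a assume "a \<in> U ` space M \<times> T ` space M"
    then obtain u t where a: "a = (u, t)" "u \<in> U ` space M" "t \<in> T ` space M" by auto
    have "emeasure (distr M (?S \<Otimes>\<^sub>M ?S') (\<lambda>\<omega>. (U \<omega>, T \<omega>))) {a} =
        emeasure M {\<omega>\<in>space M. U \<omega> = u \<and> T \<omega> = t}"
    proof (subst emeasure_distr[OF pair])
      show "{a} \<in> sets (?S \<Otimes>\<^sub>M ?S')" unfolding prod using a by simp
      show "emeasure M ((\<lambda>\<omega>. (U \<omega>, T \<omega>)) -` {a} \<inter> space M) = emeasure M {\<omega>\<in>space M. U \<omega> = u \<and> T \<omega> = t}"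
        by (rule arg_cong[where f = "emeasure M"]) (auto simp: a(1))
    qed
    also have "\<dots> = emeasure M {\<omega>\<in>space M. U \<omega> = u} * emeasure M {\<omega>\<in>space M. T \<omega> = t}"
      unfolding emeasure_eq_measure indep[OF a(2,3)] by (simp add: ennreal_mult)
    also have "emeasure M {\<omega>\<in>space M. U \<omega> = u} = emeasure (distr M ?S U) {u}"
      using a(2) by (subst emeasure_distr[OF meas(1)]) (auto intro!: arg_cong[where f = "emeasure M"])
    also have "emeasure M {\<omega>\<in>space M. T \<omega> = t} = emeasure (distr M ?S' T) {t}"
      using a(3) by (subst emeasure_distr[OF meas(2)]) (auto intro!: arg_cong[where f = "emeasure M"])
    also have "emeasure (distr M ?S U) {u} * emeasure (distr M ?S' T) {t} =
        emeasure (distr M ?S U \<Otimes>\<^sub>M distr M ?S' T) ({u} \<times> {t})"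
      using a by (intro Q.emeasure_pair_measure_Times[symmetric]) simp_all
    also have "{u} \<times> {t} = {a}" using a(1) by simp
    finally show "emeasure (distr M (?S \<Otimes>\<^sub>M ?S') (\<lambda>\<omega>. (U \<omega>, T \<omega>))) {a} =
        emeasure (distr M ?S U \<Otimes>\<^sub>M distr M ?S' T) {a}" .
  qed
  then show ?thesis
    unfolding mutual_information_def by (simp only: PQ.KL_same_eq_0)
qed

text \<open>If \<^term>\<open>Z\<close> is uniform and independent of \<^term>\<open>T\<close>, then the fibre sizes determine the conditional
  distribution of \<^term>\<open>F (T \<omega>) (Z \<omega>)\<close> given \<^term>\<open>T\<close>.\<close>

lemma (in prob_space) mutual_information_equal_fibres:
  assumes fin: "finite (T ` space M)" "finite A"
    and Z: "\<And>\<omega>. \<omega> \<in> space M \<Longrightarrow> Z \<omega> \<in> A"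
    and ev: "\<And>\<zeta>. \<zeta> \<in> A \<Longrightarrow> {\<omega>\<in>space M. Z \<omega> = \<zeta>} \<in> events"
      "\<And>t. t \<in> T ` space M \<Longrightarrow> {\<omega>\<in>space M. T \<omega> = t} \<in> events"
    and joint: "\<And>\<zeta> t. \<zeta> \<in> A \<Longrightarrow> t \<in> T ` space M \<Longrightarrow>
      prob ({\<omega>\<in>space M. Z \<omega> = \<zeta>} \<inter> {\<omega>\<in>space M. T \<omega> = t}) = c * prob {\<omega>\<in>space M. T \<omega> = t}"
    and U: "\<And>\<omega>. \<omega> \<in> space M \<Longrightarrow> U \<omega> = F (T \<omega>) (Z \<omega>)"
    and fibres: "\<And>t t' u. t \<in> T ` space M \<Longrightarrow> t' \<in> T ` space M \<Longrightarrow>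
      card {\<zeta>\<in>A. F t \<zeta> = u} = card {\<zeta>\<in>A. F t' \<zeta> = u}"
  shows "mutual_information b (count_space (U ` space M)) (count_space (T ` space M)) U T = 0"
proof -
  let ?T = "T ` space M"
  let ?E = "\<lambda>\<zeta> t. {\<omega>\<in>space M. Z \<omega> = \<zeta>} \<inter> {\<omega>\<in>space M. T \<omega> = t}"
  obtain \<omega>0 where \<omega>0: "\<omega>0 \<in> space M" using not_empty by blast
  \<comment> \<open>By \<open>fibres\<close> the count is the same for all values of
    \<open>T\<close>, so one reference outcome fixes it.\<close>
  define n where "n u = card {\<zeta>\<in>A. F (T \<omega>0) \<zeta> = u}" for u
  have E: "?E \<zeta> t \<in> events" if "\<zeta> \<in> A" "t \<in> ?T" for \<zeta> t
    using ev(1)[OF that(1)] ev(2)[OF that(2)] by (rule sets.Int)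
  \<comment> \<open>The event splits disjointly according to the noise values in the fibre of
    \<open>F t\<close> over \<open>u\<close>.\<close>
  have UT: "{\<omega>\<in>space M. U \<omega> = u \<and> T \<omega> = t} = (\<Union>\<zeta>\<in>{\<zeta>\<in>A. F t \<zeta> = u}. ?E \<zeta> t)" for u t
    using Z U by auto
  have UT_ev: "{\<omega>\<in>space M. U \<omega> = u \<and> T \<omega> = t} \<in> events" if "t \<in> ?T" for u t
    unfolding UT using fin(2) E that by (intro sets.finite_UN) auto
  have pUT: "prob {\<omega>\<in>space M. U \<omega> = u \<and> T \<omega> = t} = n u * c * prob {\<omega>\<in>space M. T \<omega> = t}"
    if t: "t \<in> ?T" for u t
  proof -
    have "prob {\<omega>\<in>space M. U \<omega> = u \<and> T \<omega> = t} = (\<Sum>\<zeta>\<in>{\<zeta>\<in>A. F t \<zeta> = u}. prob (?E \<zeta> t))"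
      unfolding UT
      by (intro finite_measure_finite_Union) (use fin(2) E t in \<open>auto simp: disjoint_family_on_def\<close>)
    also have "\<dots> = (\<Sum>\<zeta>\<in>{\<zeta>\<in>A. F t \<zeta> = u}. c * prob {\<omega>\<in>space M. T \<omega> = t})"
      using t by (intro sum.cong joint) auto
    also have "\<dots> = n u * c * prob {\<omega>\<in>space M. T \<omega> = t}"
      unfolding n_def using fibres[OF t, of "T \<omega>0" u] \<omega>0 by simp
    finally show ?thesis .
  qed
  have U_eq: "{\<omega>\<in>space M. U \<omega> = u} = (\<Union>t\<in>?T. {\<omega>\<in>space M. U \<omega> = u \<and> T \<omega> = t})" for u
    by auto
  have U_ev: "{\<omega>\<in>space M. U \<omega> = u} \<in> events" for u
    unfolding U_eq[of u] using UT_ev fin(1) by (intro sets.finite_UN) auto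
  have "(\<Sum>t\<in>?T. prob {\<omega>\<in>space M. T \<omega> = t}) = prob (\<Union>t\<in>?T. {\<omega>\<in>space M. T \<omega> = t})"
    by (intro finite_measure_finite_Union[symmetric])
       (use fin(1) ev(2) in \<open>auto simp: disjoint_family_on_def\<close>)
  also have "(\<Union>t\<in>?T. {\<omega>\<in>space M. T \<omega> = t}) = space M" by auto
  finally have total: "(\<Sum>t\<in>?T. prob {\<omega>\<in>space M. T \<omega> = t}) = 1" by (simp add: prob_space)
  \<comment> \<open>Summing out \<open>t\<close> leaves \<open>n u * c\<close>, because the
    probabilities of the values of \<open>T\<close> add up to 1; comparison with \<open>pUT\<close>
    gives the factorization.\<close>
  have pU: "prob {\<omega>\<in>space M. U \<omega> = u} = n u * c" for u
  proof -
    have "prob {\<omega>\<in>space M. U \<omega> = u} = (\<Sum>t\<in>?T. prob {\<omega>\<in>space M. U \<omega> = u \<and> T \<omega> = t})"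
      unfolding U_eq[of u]
      by (intro finite_measure_finite_Union) (use fin(1) UT_ev in \<open>auto simp: disjoint_family_on_def\<close>)
    also have "\<dots> = (\<Sum>t\<in>?T. n u * c * prob {\<omega>\<in>space M. T \<omega> = t})"
      by (intro sum.cong pUT) auto
    also have "\<dots> = n u * c" unfolding sum_distrib_left[symmetric] total by simp
    finally show ?thesis .
  qed
  have "U ` space M \<subseteq> (\<lambda>(t, \<zeta>). F t \<zeta>) ` (?T \<times> A)"
    using U Z by auto
  then have finU: "finite (U ` space M)" using fin finite_subset by blast
  show ?thesis
  proof (rule mutual_information_indep_finite)
    show "U \<in> measurable M (count_space (U ` space M))"
      using U_ev finU by (subst measurable_count_space_eq2) (auto simp: vimage_def Int_def conj_commute)
    show "T \<in> measurable M (count_space ?T)"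
      using ev(2) fin(1) by (subst measurable_count_space_eq2) (auto simp: vimage_def Int_def conj_commute)
    fix u t assume "t \<in> ?T"
    then show "prob {\<omega>\<in>space M. U \<omega> = u \<and> T \<omega> = t} =
        prob {\<omega>\<in>space M. U \<omega> = u} * prob {\<omega>\<in>space M. T \<omega> = t}"
      by (simp only: pUT pU)
  qed fact+
qed

section \<open>Compensating a change of data by a translation of the noise\<close>

context csa_code
begin

text \<open>Data and noise are separate arguments so that fibres over fixed data can be counted. The
  noise of a source is one function of triples, and restriction makes equality mean equality of what
  the servers in \<open>\<X>\<close> see.\<close>

definition shares ::
  "nat set \<Rightarrow> (nat \<Rightarrow> 'v) \<Rightarrow> (nat \<times> nat \<times> nat \<Rightarrow> 'v) \<Rightarrow> nat \<Rightarrow> nat \<Rightarrow> 'v" where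
  "shares \<X> x \<zeta> =
    (\<lambda>s\<in>\<X>. \<lambda>l\<in>{1..ell}. csa_share scaleV Kc X f \<alpha> x (\<lambda>l k t. \<zeta> (l, k, t)) s l)"

abbreviation noise_index :: "(nat \<times> nat \<times> nat) set" where
  "noise_index \<equiv> {1..ell} \<times> {1..Kc} \<times> {1..X}"

text \<open>Interpolation at the \<open>X\<close> points \<open>\<alpha>\<^sub>s\<close> absorbs any change of the data into a translation of the
  noise with \<open>k = 1\<close>.\<close>

lemma noise_translation:
  assumes U: "VV.subspace U" and \<X>: "\<X> \<subseteq> {1..S}" "card \<X> = X"
    and x: "\<And>i. i \<in> {1..ell * Kc} \<Longrightarrow> x i \<in> U" "\<And>i. i \<in> {1..ell * Kc} \<Longrightarrow> x' i \<in> U"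
  shows "\<exists>h \<in> noise_index \<rightarrow> U. \<forall>\<zeta>. shares \<X> x' (\<lambda>j\<in>noise_index. \<zeta> j + h j) = shares \<X> x \<zeta>"
proof -
  \<comment> \<open>The change in the data part of the share, before the factor
    \<open>csa_Delta\<close>, that the new noise has to make up for at server
    \<open>s\<close>.\<close>
  define y where "y l s = (\<Sum>k\<in>{1..Kc}. scaleV (1 / (f l k - \<alpha> s))
    (x (Kc * (l - 1) + k) - x' (Kc * (l - 1) + k)))" for l s
  have inj: "inj_on \<alpha> \<X>" using inj_on_\<alpha> \<X>(1) by (rule inj_on_subset)
  have fin: "finite \<X>" using \<X>(1) finite_subset by blast
  have "\<exists>c. (\<forall>i<X. c i \<in> U) \<and> (\<forall>s\<in>\<X>. (\<Sum>i<X. scaleV (\<alpha> s ^ i) (c i)) = y l s)" if l: "l \<in> {1..ell}" for l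
  proof -
    have "y l s \<in> U" for s
      unfolding y_def using block_index_in[OF l] x
      by (intro VV.subspace_sum VV.subspace_scale VV.subspace_diff U) blast+
    then obtain p where p: "VV.polyfun U (card (\<alpha> ` \<X>)) p" "\<forall>a\<in>\<alpha> ` \<X>. p a = y l (inv_into \<X> \<alpha> a)"
      using VV.polyfun_interpolation[OF U, of "\<alpha> ` \<X>" "\<lambda>a. y l (inv_into \<X> \<alpha> a)"] fin by blast
    then have "\<forall>s\<in>\<X>. p (\<alpha> s) = y l s" using inj by simp
    \<comment> \<open>Injectivity of \<open>\<alpha>\<close> gives exactly \<open>X\<close> nodes,
      hence \<open>X\<close> coefficients, one for each noise vector with fixed \<open>l\<close> and
      \<open>k\<close>.\<close>
    moreover obtain c where "\<forall>i<X. c i \<in> U" "\<forall>a. p a = (\<Sum>i<X. scaleV (a ^ i) (c i))"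
      using p(1) unfolding VV.polyfun_def card_image[OF inj] \<X>(2) by blast
    ultimately show ?thesis by (intro exI[of _ c]) auto
  qed
  then obtain c where c: "\<And>l i. l \<in> {1..ell} \<Longrightarrow> i < X \<Longrightarrow> c l i \<in> U"
    "\<And>l s. l \<in> {1..ell} \<Longrightarrow> s \<in> \<X> \<Longrightarrow> (\<Sum>i<X. scaleV (\<alpha> s ^ i) (c l i)) = y l s"
    by metis
  \<comment> \<open>The noise vector with index \<open>t\<close> multiplies the power
    \<open>t - 1\<close>, hence the shifted coefficient index.\<close>
  define h where "h = (\<lambda>(l, k, t). if k = (1::nat) then c l (t - 1) else 0)"
  have "csa_share scaleV Kc X f \<alpha> x' (\<lambda>l k t. (\<lambda>j\<in>noise_index. \<zeta> j + h j) (l, k, t)) s l =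
      csa_share scaleV Kc X f \<alpha> x (\<lambda>l k t. \<zeta> (l, k, t)) s l" if s: "s \<in> \<X>" and l: "l \<in> {1..ell}" for \<zeta> s l
  proof -
    \<comment> \<open>The factor \<open>csa_Delta\<close> is common to both shares, so it suffices
      that data part plus noise part is unchanged.\<close>
    let ?pole = "\<lambda>x. \<Sum>k\<in>{1..Kc}. scaleV (1 / (f l k - \<alpha> s)) (x (Kc * (l - 1) + k))"
    let ?noise = "\<lambda>\<zeta>. \<Sum>k\<in>{1..Kc}. \<Sum>t\<in>{1..X}. scaleV (\<alpha> s ^ (t - 1)) (\<zeta> (l, k, t))"
    have "?noise (\<lambda>j\<in>noise_index. \<zeta> j + h j) = ?noise (\<lambda>j. \<zeta> j + h j)"
      using l by (intro sum.cong) auto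
    also have "\<dots> = ?noise \<zeta> + ?noise h"
      by (simp add: VV.scale_right_distrib sum.distrib)
    also have "?noise h = (\<Sum>k\<in>{1..Kc}. if k = 1 then \<Sum>t\<in>{1..X}. scaleV (\<alpha> s ^ (t - 1)) (c l (t - 1)) else 0)"
      by (intro sum.cong) (auto simp: h_def)
    also have "\<dots> = (\<Sum>t\<in>{1..X}. scaleV (\<alpha> s ^ (t - 1)) (c l (t - 1)))"
      using Kc by simp
    also have "\<dots> = y l s"
      unfolding c(2)[OF l s, symmetric] by (simp add: sum.atLeast1_atMost_eq)
    also have "y l s = ?pole x - ?pole x'"
      unfolding y_def by (simp add: VV.scale_right_diff_distrib sum_subtractf)
    finally have "?pole x' + ?noise (\<lambda>j\<in>noise_index. \<zeta> j + h j) = ?pole x + ?noise \<zeta>"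
      by simp
    then show ?thesis unfolding csa_share_def sum.distrib by simp
  qed
  then have "shares \<X> x' (\<lambda>j\<in>noise_index. \<zeta> j + h j) = shares \<X> x \<zeta>" for \<zeta>
    unfolding shares_def by (intro restrict_ext)
  moreover have "h \<in> noise_index \<rightarrow> U"
    using c(1) VV.subspace_0[OF U] by (auto simp: h_def)
  ultimately show ?thesis by blast
qed

text \<open>Translating the noise maps one fibre injectively into the other; exchanging
  \<open>x\<close> and \<open>x'\<close> gives the opposite inequality.\<close>

lemma card_shares_fibre:
  assumes U: "VV.subspace U" "finite U" and \<X>: "\<X> \<subseteq> {1..S}" "card \<X> = X"
    and x: "\<And>i. i \<in> {1..ell * Kc} \<Longrightarrow> x i \<in> U" "\<And>i. i \<in> {1..ell * Kc} \<Longrightarrow> x' i \<in> U"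
  shows "card {\<zeta> \<in> noise_index \<rightarrow>\<^sub>E U. shares \<X> x \<zeta> = u} = card {\<zeta> \<in> noise_index \<rightarrow>\<^sub>E U. shares \<X> x' \<zeta> = u}"
proof -
  have le: "card {\<zeta> \<in> noise_index \<rightarrow>\<^sub>E U. shares \<X> x \<zeta> = u} \<le> card {\<zeta> \<in> noise_index \<rightarrow>\<^sub>E U. shares \<X> x' \<zeta> = u}"
    if x: "\<And>i. i \<in> {1..ell * Kc} \<Longrightarrow> x i \<in> U" "\<And>i. i \<in> {1..ell * Kc} \<Longrightarrow> x' i \<in> U" for x x'
  proof -
    obtain h where h: "h \<in> noise_index \<rightarrow> U"
      "\<And>\<zeta>. shares \<X> x' (\<lambda>j\<in>noise_index. \<zeta> j + h j) = shares \<X> x \<zeta>"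
      using noise_translation[of U \<X> x x', OF U(1) \<X> x] by blast
    show ?thesis
    proof (rule card_inj_on_le[where f = "\<lambda>\<zeta>. \<lambda>j\<in>noise_index. \<zeta> j + h j"])
      show "inj_on (\<lambda>\<zeta>. \<lambda>j\<in>noise_index. \<zeta> j + h j) {\<zeta> \<in> noise_index \<rightarrow>\<^sub>E U. shares \<X> x \<zeta> = u}"
      proof (rule inj_onI)
        fix \<zeta> \<zeta>' assume \<zeta>: "\<zeta> \<in> {\<zeta> \<in> noise_index \<rightarrow>\<^sub>E U. shares \<X> x \<zeta> = u}"
          "\<zeta>' \<in> {\<zeta> \<in> noise_index \<rightarrow>\<^sub>E U. shares \<X> x \<zeta> = u}"
          and eq: "(\<lambda>j\<in>noise_index. \<zeta> j + h j) = (\<lambda>j\<in>noise_index. \<zeta>' j + h j)"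
        show "\<zeta> = \<zeta>'"
        proof (rule PiE_ext)
          show "\<zeta> \<in> noise_index \<rightarrow>\<^sub>E U" "\<zeta>' \<in> noise_index \<rightarrow>\<^sub>E U" using \<zeta> by blast+
          show "\<zeta> j = \<zeta>' j" if "j \<in> noise_index" for j
            using fun_cong[OF eq, of j] that by (simp only: restrict_apply' add_right_cancel)
        qed
      qed
      show "(\<lambda>\<zeta>. \<lambda>j\<in>noise_index. \<zeta> j + h j) ` {\<zeta> \<in> noise_index \<rightarrow>\<^sub>E U. shares \<X> x \<zeta> = u}
          \<subseteq> {\<zeta> \<in> noise_index \<rightarrow>\<^sub>E U. shares \<X> x' \<zeta> = u}"
      proof (intro image_subsetI CollectI conjI)
        fix \<zeta> assume \<zeta>: "\<zeta> \<in> {\<zeta> \<in> noise_index \<rightarrow>\<^sub>E U. shares \<X> x \<zeta> = u}"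
        then show "shares \<X> x' (\<lambda>j\<in>noise_index. \<zeta> j + h j) = u" unfolding h(2) by blast
        have "\<zeta> j + h j \<in> U" if "j \<in> noise_index" for j
          using \<zeta> h(1) that by (intro VV.subspace_add U) blast+
        then show "(\<lambda>j\<in>noise_index. \<zeta> j + h j) \<in> noise_index \<rightarrow>\<^sub>E U"
          unfolding restrict_PiE_iff by blast
      qed
      show "finite {\<zeta> \<in> noise_index \<rightarrow>\<^sub>E U. shares \<X> x' \<zeta> = u}"
        using U(2) by (intro finite_subset[OF _ finite_PiE[of noise_index "\<lambda>_. U"]]) auto
    qed
  qed
  show ?thesis by (intro antisym le x)
qed

section \<open>Independence of the shares from the data\<close>

text \<open>The criterion of equal fibres is applied to the noise \<open>Z\<close> and the data
  \<open>T\<close> of source \<open>n\<close>; the work lies in transferring uniformity and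
  independence from the families over all sources.\<close>

lemma shares_independent_of_data:
  fixes M :: "'m measure"
  assumes model: "csa_random_model M N ell Kc X V x z"
    and finV: "\<And>m. m \<in> {1..N} \<Longrightarrow> finite (V m)"
    and n: "n \<in> {1..N}" and \<X>: "\<X> \<subseteq> {1..S}" "card \<X> = X"
  shows "discrete_mutual_information M b
    (\<lambda>\<omega>. \<lambda>s\<in>\<X>. \<lambda>l\<in>{1..ell}. csa_share scaleV Kc X f \<alpha> (x \<omega> n) (z \<omega> n) s l)
    (\<lambda>\<omega>. \<lambda>l\<in>{1..ell * Kc}. x \<omega> n l) = 0"
proof -
  define D where "D = {1..N} \<times> {1..ell * Kc}"
  define I where "I = {1..N} \<times> noise_index"
  define MD where "MD = (\<lambda>(n, l :: nat). count_space (V n))"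
  define MI where "MI = (\<lambda>(n, l :: nat, k :: nat, t :: nat). count_space (V n))"
  define data where "data = (\<lambda>\<omega>. \<lambda>(n, l)\<in>D. x \<omega> n l)"
  define noise where "noise = (\<lambda>\<omega>. \<lambda>(n, l, k, t)\<in>I. z \<omega> n l k t)"
  note model' = model[unfolded csa_random_model_def Let_def, folded D_def I_def MD_def MI_def,
    folded data_def noise_def]
  interpret prob_space M using model' by blast
  have x_meas: "(\<lambda>\<omega>. x \<omega> m l) \<in> measurable M (count_space (V m))" if "(m, l) \<in> D" for m l
    using model' that by blast
  have z_meas: "(\<lambda>\<omega>. z \<omega> m l k t) \<in> measurable M (count_space (V m))"
    and z_distr: "distr M (count_space (V m)) (\<lambda>\<omega>. z \<omega> m l k t) = uniform_count_measure (V m)"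
    if "(m, l, k, t) \<in> I" for m l k t
    using model' that by blast+
  have indep_noise: "indep_vars MI (\<lambda>(n, l, k, t) \<omega>. z \<omega> n l k t) I"
    and indep: "indep_set (sets (vimage_algebra (space M) noise (Pi\<^sub>M I MI)))
      (sets (vimage_algebra (space M) data (Pi\<^sub>M D MD)))"
    using model' by blast+
  have x_in: "x \<omega> m l \<in> V m" if "\<omega> \<in> space M" "(m, l) \<in> D" for \<omega> m l
    using measurable_space[OF x_meas[OF that(2)] that(1)] by simp
  have z_in: "z \<omega> m l k t \<in> V m" if "\<omega> \<in> space M" "(m, l, k, t) \<in> I" for \<omega> m l k t
    using measurable_space[OF z_meas[OF that(2)] that(1)] by simp

  define T where "T = (\<lambda>\<omega>. \<lambda>l\<in>{1..ell * Kc}. x \<omega> n l)"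
  define Z where "Z = (\<lambda>\<omega>. \<lambda>(l, k, t)\<in>noise_index. z \<omega> n l k t)"
  define A where "A = noise_index \<rightarrow>\<^sub>E V n"
  have finI: "finite noise_index" "finite I" "finite D" unfolding I_def D_def by auto
  have nI: "(n, j) \<in> I" if "j \<in> noise_index" for j using n that unfolding I_def by simp
  have nD: "(n, l) \<in> D" if "l \<in> {1..ell * Kc}" for l using n that unfolding D_def by simp

  have Z_in: "Z \<omega> \<in> A" if \<omega>: "\<omega> \<in> space M" for \<omega>
  proof -
    have "(\<lambda>(l, k, t). z \<omega> n l k t) j \<in> V n" if "j \<in> noise_index" for j
      using z_in[OF \<omega>] nI[OF that] by (cases j) simp
    then show ?thesis unfolding Z_def A_def by (simp only: restrict_PiE_iff) blast
  qed
  have T_in: "T \<omega> \<in> {1..ell * Kc} \<rightarrow>\<^sub>E V n" if "\<omega> \<in> space M" for \<omega>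
    unfolding T_def restrict_PiE_iff using x_in[OF that] nD by blast
  have finT: "finite (T ` space M)"
    using T_in finV[OF n] by (intro finite_subset[OF _ finite_PiE[of "{1..ell * Kc}" "\<lambda>_. V n"]]) auto

  \<comment> \<open>Independence from the data is given for the sigma-algebra generated by the noise
    of all sources, so the event has to be found there.\<close>
  have Z_ev: "{\<omega>\<in>space M. Z \<omega> = \<zeta>} \<in> sets (vimage_algebra (space M) noise (Pi\<^sub>M I MI))"
    if \<zeta>: "\<zeta> \<in> A" for \<zeta>
  proof -
    \<comment> \<open>A cylinder: the noise of source \<open>n\<close> is prescribed, that of the
      other sources is unrestricted.\<close>
    define E where "E = (\<lambda>(m, j). if m = n then {\<zeta> j} else V m)"
    have "E i \<in> sets (MI i)" if "i \<in> I" for i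
      using that \<zeta> unfolding E_def MI_def A_def I_def by (auto simp: PiE_iff)
    then have "Pi\<^sub>E I E \<in> sets (Pi\<^sub>M I MI)" using finI by (intro sets_PiM_I_finite)
    moreover have "noise -` Pi\<^sub>E I E \<inter> space M = {\<omega>\<in>space M. Z \<omega> = \<zeta>}"
    proof (intro set_eqI iffI)
      fix \<omega> assume "\<omega> \<in> noise -` Pi\<^sub>E I E \<inter> space M"
      then have \<omega>: "\<omega> \<in> space M" "noise \<omega> \<in> Pi\<^sub>E I E" by blast+
      have "Z \<omega> = \<zeta>"
      proof (rule PiE_ext)
        show "Z \<omega> \<in> noise_index \<rightarrow>\<^sub>E V n" "\<zeta> \<in> noise_index \<rightarrow>\<^sub>E V n"
          using Z_in[OF \<omega>(1)] \<zeta> unfolding A_def by blast+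
        fix j assume j: "j \<in> noise_index"
        show "Z \<omega> j = \<zeta> j"
          using PiE_mem[OF \<omega>(2) nI[OF j]] nI[OF j] j
          by (cases j) (simp add: noise_def Z_def E_def)
      qed
      then show "\<omega> \<in> {\<omega>\<in>space M. Z \<omega> = \<zeta>}" using \<omega> by blast
    next
      fix \<omega> assume "\<omega> \<in> {\<omega>\<in>space M. Z \<omega> = \<zeta>}"
      then have \<omega>: "\<omega> \<in> space M" and \<zeta>': "\<zeta> = Z \<omega>" by blast+
      have "(\<lambda>(m, l, k, t). z \<omega> m l k t) i \<in> E i" if i: "i \<in> I" for i
        using z_in[OF \<omega>] i unfolding \<zeta>' E_def Z_def I_def by (cases i) auto
      then have "noise \<omega> \<in> Pi\<^sub>E I E" unfolding noise_def restrict_PiE_iff by blast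
      then show "\<omega> \<in> noise -` Pi\<^sub>E I E \<inter> space M" using \<omega> by blast
    qed
    ultimately show ?thesis using in_vimage_algebra by metis
  qed
  have T_ev: "{\<omega>\<in>space M. T \<omega> = t} \<in> sets (vimage_algebra (space M) data (Pi\<^sub>M D MD))"
    if t: "t \<in> {1..ell * Kc} \<rightarrow>\<^sub>E V n" for t
  proof -
    define E where "E = (\<lambda>(m, l). if m = n then {t l} else V m)"
    have "E i \<in> sets (MD i)" if "i \<in> D" for i
      using that t unfolding E_def MD_def D_def by (auto simp: PiE_iff)
    then have "Pi\<^sub>E D E \<in> sets (Pi\<^sub>M D MD)" using finI by (intro sets_PiM_I_finite)
    moreover have "data -` Pi\<^sub>E D E \<inter> space M = {\<omega>\<in>space M. T \<omega> = t}"
    proof (intro set_eqI iffI)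
      fix \<omega> assume "\<omega> \<in> data -` Pi\<^sub>E D E \<inter> space M"
      then have \<omega>: "\<omega> \<in> space M" "data \<omega> \<in> Pi\<^sub>E D E" by blast+
      have "T \<omega> = t"
      proof (rule PiE_ext)
        show "T \<omega> \<in> {1..ell * Kc} \<rightarrow>\<^sub>E V n" "t \<in> {1..ell * Kc} \<rightarrow>\<^sub>E V n"
          using T_in[OF \<omega>(1)] t by blast+
        fix l assume l: "l \<in> {1..ell * Kc}"
        show "T \<omega> l = t l"
          using PiE_mem[OF \<omega>(2) nD[OF l]] nD[OF l] l by (simp add: data_def T_def E_def)
      qed
      then show "\<omega> \<in> {\<omega>\<in>space M. T \<omega> = t}" using \<omega> by blast
    next
      fix \<omega> assume "\<omega> \<in> {\<omega>\<in>space M. T \<omega> = t}"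
      then have \<omega>: "\<omega> \<in> space M" and t': "t = T \<omega>" by blast+
      have "(\<lambda>(m, l). x \<omega> m l) i \<in> E i" if i: "i \<in> D" for i
        using x_in[OF \<omega>] i unfolding t' E_def T_def D_def by (cases i) auto
      then have "data \<omega> \<in> Pi\<^sub>E D E" unfolding data_def restrict_PiE_iff by blast
      then show "\<omega> \<in> data -` Pi\<^sub>E D E \<inter> space M" using \<omega> by blast
    qed
    ultimately show ?thesis using in_vimage_algebra by metis
  qed

  have prob_Z: "prob {\<omega>\<in>space M. Z \<omega> = \<zeta>} = (1 / card (V n)) ^ card noise_index" if \<zeta>: "\<zeta> \<in> A" for \<zeta>
  proof (cases "noise_index = {}")
    \<comment> \<open>Without noise vectors, as for \<open>X = 0\<close>, \<open>A\<close> has a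
      single element and the event is certain; the product rule of the other case asks for a
      nonempty index set.\<close>
    case True
    have "Z \<omega> = \<zeta>" if "\<omega> \<in> space M" for \<omega>
      using Z_in[OF that] \<zeta> unfolding A_def True by simp
    then have "{\<omega>\<in>space M. Z \<omega> = \<zeta>} = space M" by blast
    then show ?thesis by (simp only: True prob_space card.empty power_0)
  next
    case False
    let ?W = "\<lambda>(n, l, k, t) \<omega>. z \<omega> n l k t"
    let ?J = "Pair n ` noise_index"
    have z\<zeta>: "{\<omega>\<in>space M. Z \<omega> = \<zeta>} = (\<Inter>i\<in>?J. ?W i -` {\<zeta> (snd i)} \<inter> space M)"
    proof (intro set_eqI iffI)
      fix \<omega> assume "\<omega> \<in> {\<omega>\<in>space M. Z \<omega> = \<zeta>}"
      then show "\<omega> \<in> (\<Inter>i\<in>?J. ?W i -` {\<zeta> (snd i)} \<inter> space M)" by (auto simp: Z_def)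
    next
      fix \<omega> assume \<omega>: "\<omega> \<in> (\<Inter>i\<in>?J. ?W i -` {\<zeta> (snd i)} \<inter> space M)"
      then have sp: "\<omega> \<in> space M" using False by blast
      have "Z \<omega> = \<zeta>"
      proof (rule PiE_ext)
        show "Z \<omega> \<in> noise_index \<rightarrow>\<^sub>E V n" "\<zeta> \<in> noise_index \<rightarrow>\<^sub>E V n"
          using Z_in[OF sp] \<zeta> unfolding A_def by blast+
        fix j assume j: "j \<in> noise_index"
        then have "\<omega> \<in> ?W (n, j) -` {\<zeta> (snd (n, j))} \<inter> space M" using \<omega> by blast
        then show "Z \<omega> j = \<zeta> j" using j by (cases j) (simp add: Z_def)
      qed
      then show "\<omega> \<in> {\<omega>\<in>space M. Z \<omega> = \<zeta>}" using sp by blast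
    qed
    have "prob {\<omega>\<in>space M. Z \<omega> = \<zeta>} = (\<Prod>i\<in>?J. prob (?W i -` {\<zeta> (snd i)} \<inter> space M))"
      unfolding z\<zeta>
    proof (rule indep_varsD[OF indep_noise])
      show "?J \<noteq> {}" "finite ?J" using False finI by auto
      show "?J \<subseteq> I" using nI by blast
      show "{\<zeta> (snd i)} \<in> sets (MI i)" if "i \<in> ?J" for i
        using that \<zeta> unfolding MI_def A_def by (auto simp: PiE_iff)
    qed
    also have "\<dots> = (\<Prod>i\<in>?J. 1 / card (V n))"
    proof (rule prod.cong[OF refl])
      fix i assume "i \<in> ?J"
      then obtain l k t where i: "i = (n, l, k, t)" "(l, k, t) \<in> noise_index" by auto
      have v: "\<zeta> (l, k, t) \<in> V n" using \<zeta> i(2) unfolding A_def by (rule PiE_mem)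
      have "prob (?W i -` {\<zeta> (snd i)} \<inter> space M) =
          measure (distr M (count_space (V n)) (\<lambda>\<omega>. z \<omega> n l k t)) {\<zeta> (l, k, t)}"
        using v by (subst measure_distr[OF z_meas[OF nI[OF i(2)]]]) (simp_all add: i(1))
      also have "\<dots> = 1 / card (V n)"
        unfolding z_distr[OF nI[OF i(2)]] using v finV[OF n] by (simp add: measure_uniform_count_measure)
      finally show "prob (?W i -` {\<zeta> (snd i)} \<inter> space M) = 1 / card (V n)" .
    qed
    also have "\<dots> = (1 / card (V n)) ^ card noise_index"
      unfolding prod_constant by (subst card_image) (auto simp: inj_on_def)
    finally show ?thesis .
  qed

  show ?thesis
    unfolding discrete_mutual_information_def T_def[symmetric]
  \<comment> \<open>\<open>c\<close> is the probability of a single noise value, as \<open>Z\<close>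
    is uniform on \<open>A\<close>.\<close>
  proof (rule mutual_information_equal_fibres[where F = "shares \<X>" and A = A and Z = Z
        and c = "(1 / card (V n)) ^ card noise_index"])
    show "finite A" unfolding A_def using finI(1) finV[OF n] by (intro finite_PiE)
    fix \<zeta> t assume \<zeta>: "\<zeta> \<in> A" and "t \<in> T ` space M"
    then have t: "t \<in> {1..ell * Kc} \<rightarrow>\<^sub>E V n" using T_in by blast
    show "prob ({\<omega>\<in>space M. Z \<omega> = \<zeta>} \<inter> {\<omega>\<in>space M. T \<omega> = t}) =
        (1 / card (V n)) ^ card noise_index * prob {\<omega>\<in>space M. T \<omega> = t}"
      using indep_setD[OF indep Z_ev[OF \<zeta>] T_ev[OF t]] unfolding prob_Z[OF \<zeta>] .
  next
    fix \<zeta> assume "\<zeta> \<in> A"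
    then show "{\<omega>\<in>space M. Z \<omega> = \<zeta>} \<in> events" using Z_ev indep_setD_ev1[OF indep] by blast
  next
    fix t assume "t \<in> T ` space M"
    then show "{\<omega>\<in>space M. T \<omega> = t} \<in> events" using T_in T_ev indep_setD_ev2[OF indep] by blast
  next
    fix t t' u assume "t \<in> T ` space M" "t' \<in> T ` space M"
    then have "t \<in> {1..ell * Kc} \<rightarrow>\<^sub>E V n" "t' \<in> {1..ell * Kc} \<rightarrow>\<^sub>E V n" using T_in by blast+
    then show "card {\<zeta> \<in> A. shares \<X> t \<zeta> = u} = card {\<zeta> \<in> A. shares \<X> t' \<zeta> = u}"
      unfolding A_def using finV[OF n] by (intro card_shares_fibre subspace_V n \<X>) (blast dest: PiE_mem)+
  next
    fix \<omega>
    \<comment> \<open>A share reads data and noise only at indices to which \<open>T\<close> and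
      \<open>Z\<close> are restricted.\<close>
    have "csa_share scaleV Kc X f \<alpha> (x \<omega> n) (z \<omega> n) s l =
        csa_share scaleV Kc X f \<alpha> (T \<omega>) (\<lambda>l k t. Z \<omega> (l, k, t)) s l" if l: "l \<in> {1..ell}" for s l
    proof -
      have "x \<omega> n (Kc * (l - 1) + k) = T \<omega> (Kc * (l - 1) + k)" if "k \<in> {1..Kc}" for k
        unfolding T_def using block_index_in[OF l that] by (simp only: restrict_apply')
      moreover have "z \<omega> n l k t = Z \<omega> (l, k, t)" if "k \<in> {1..Kc}" "t \<in> {1..X}" for k t
        unfolding Z_def using l that by simp
      ultimately show ?thesis
        unfolding csa_share_def
        by (intro arg_cong[where f = "scaleV _"] sum.cong refl arg_cong2[where f = "(+)"]) simp_all
    qed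
    then show "(\<lambda>s\<in>\<X>. \<lambda>l\<in>{1..ell}. csa_share scaleV Kc X f \<alpha> (x \<omega> n) (z \<omega> n) s l) =
        shares \<X> (T \<omega>) (Z \<omega>)"
      unfolding shares_def by (intro restrict_ext)
  qed (fact finT Z_in)+
qed

end

section \<open>Security and recovery of the code\<close>

theorem mainTheorem5:
  fixes N S ell Kc X B L R :: nat
    and scaleV :: "'q::{field,finite} \<Rightarrow> 'v::ab_group_add \<Rightarrow> 'v"
    and scaleW :: "'q \<Rightarrow> 'w::ab_group_add \<Rightarrow> 'w"
    and V :: "nat \<Rightarrow> 'v set"
    and \<Omega> :: "(nat \<Rightarrow> 'v) \<Rightarrow> 'w"
    and f :: "nat \<Rightarrow> nat \<Rightarrow> 'q"
    and \<alpha> :: "nat \<Rightarrow> 'q"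
  assumes "N \<ge> 1" "S \<ge> 1" "ell \<ge> 1" "Kc \<ge> 1" "X \<le> S"
    and "L = ell * Kc"
    and "int R = int Kc * (int N + int ell - 1) + int N * (int X - 1) + 2 * int B + 1"
    and "CARD('q) \<ge> S + L"
    and "S \<ge> R"
    and "vector_space scaleV"
    and "\<forall>n\<in>{1..N}. fin_dim_subspace scaleV (V n)"
    and "\<exists>C. finite_dimensional_vector_space scaleW C"
    and "multilinear_map scaleV scaleW N V \<Omega>"
    and "csa_points ell Kc S f \<alpha>"
  shows
    "(\<forall>(M :: 'm measure) x z. csa_random_model M N ell Kc X V x z \<longrightarrow>
       (\<forall>n\<in>{1..N}. \<forall>\<X>. \<X> \<subseteq> {1..S} \<and> card \<X> = X \<longrightarrow>
          (\<forall>b>1. discrete_mutual_information M b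
             (\<lambda>\<omega>. \<lambda>s\<in>\<X>. \<lambda>l\<in>{1..ell}. csa_share scaleV Kc X f \<alpha> (x \<omega> n) (z \<omega> n) s l)
             (\<lambda>\<omega>. \<lambda>l\<in>{1..L}. x \<omega> n l) = 0)))
     \<and>
     (\<forall>\<R>. \<R> \<subseteq> {1..S} \<and> card \<R> = R \<longrightarrow>
       (\<exists>d \<in> (\<R> \<rightarrow>\<^sub>E UNIV) \<rightarrow> ({1..L} \<rightarrow>\<^sub>E UNIV).
          \<forall>x z. \<forall>Y' \<in> \<R> \<rightarrow>\<^sub>E UNIV.
            (\<forall>n\<in>{1..N}. \<forall>l\<in>{1..L}. x n l \<in> V n) \<and>
            (\<forall>n\<in>{1..N}. \<forall>l\<in>{1..ell}. \<forall>k\<in>{1..Kc}. \<forall>t\<in>{1..X}. z n l k t \<in> V n) \<and>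
            card {s\<in>\<R>. Y' s \<noteq> csa_answer scaleV scaleW N ell Kc X \<Omega> f \<alpha> x z s} \<le> B \<longrightarrow>
            d Y' = (\<lambda>l\<in>{1..L}. \<Omega> (\<lambda>n\<in>{1..N}. x n l))))"
proof -
  have fin_dim: "fin_dim_subspace scaleV (V n)" if "n \<in> {1..N}" for n
    using assms(11) that by blast
  interpret VV: coefficient_space scaleV by (rule coefficient_space.intro) fact
  obtain C where "finite_dimensional_vector_space scaleW C" using assms(12) by blast
  then interpret WW: finite_dimensional_vector_space scaleW C .
  interpret csa_code scaleV scaleW N V \<Omega> S ell Kc X f \<alpha>
  proof unfold_locales
    show "VV.subspace (V n)" if "n \<in> {1..N}" for n
      using fin_dim[OF that] unfolding fin_dim_subspace_def by blast
  qed fact+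
  have finV: "finite (V n)" if "n \<in> {1..N}" for n
    using fin_dim[OF that] VV.finite_span unfolding fin_dim_subspace_def by (metis finite)
  \<comment> \<open>The threshold is an integer identity since \<open>X - 1\<close> may be negative.
    \<open>Kc \<ge> 1\<close> and \<open>ell \<ge> 1\<close> keep the natural subtractions exact, so
    it passes to the form used by the decoder.\<close>
  have "int R = int (N * (Kc + X - 1) + (ell - 1) * Kc + 2 * B + 1)"
  proof -
    have "int (Kc + X - 1) = int Kc + int X - 1" "int (ell - 1) = int ell - 1"
      using assms(3,4) by simp_all
    then show ?thesis unfolding assms(7) of_nat_add of_nat_mult by (simp add: algebra_simps)
  qed
  then have R: "R = N * (Kc + X - 1) + (ell - 1) * Kc + 2 * B + 1"
    by (simp only: of_nat_eq_iff)
  show ?thesis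
  proof (intro conjI allI impI ballI)
    fix M :: "'m measure" and x z n \<X> and b :: real
    assume "csa_random_model M N ell Kc X V x z" "n \<in> {1..N}" "\<X> \<subseteq> {1..S} \<and> card \<X> = X"
    then show "discrete_mutual_information M b
        (\<lambda>\<omega>. \<lambda>s\<in>\<X>. \<lambda>l\<in>{1..ell}. csa_share scaleV Kc X f \<alpha> (x \<omega> n) (z \<omega> n) s l)
        (\<lambda>\<omega>. \<lambda>l\<in>{1..L}. x \<omega> n l) = 0"
      unfolding \<open>L = ell * Kc\<close> by (intro shares_independent_of_data finV) blast+
  next
    fix \<R> assume "\<R> \<subseteq> {1..S} \<and> card \<R> = R"
    then have "\<R> \<subseteq> {1..S}" "card \<R> = R" by blast+
    from byzantine_decoder[OF R this]
    show "\<exists>d \<in> (\<R> \<rightarrow>\<^sub>E UNIV) \<rightarrow> ({1..L} \<rightarrow>\<^sub>E UNIV). \<forall>x z. \<forall>Y' \<in> \<R> \<rightarrow>\<^sub>E UNIV.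
        (\<forall>n\<in>{1..N}. \<forall>l\<in>{1..L}. x n l \<in> V n) \<and>
        (\<forall>n\<in>{1..N}. \<forall>l\<in>{1..ell}. \<forall>k\<in>{1..Kc}. \<forall>t\<in>{1..X}. z n l k t \<in> V n) \<and>
        card {s\<in>\<R>. Y' s \<noteq> csa_answer scaleV scaleW N ell Kc X \<Omega> f \<alpha> x z s} \<le> B \<longrightarrow>
        d Y' = (\<lambda>l\<in>{1..L}. \<Omega> (\<lambda>n\<in>{1..N}. x n l))"
      unfolding valid_input_def \<open>L = ell * Kc\<close> conj_assoc .
  qed
qed

end
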